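(* Let $C\subset\mathbb{R}^d$ be a self-similar set satisfying the strong separation condition, let $s=\dim_H(C)$ and let $\mu=\mathcal{H}^s\lfloor_C$. Then for any $x\in C$, $$\operatorname{Tan}(\mu,x)=\{\,c\,\mathcal{H}^s\lfloor_F \;:\; F\in\omega(C^x),\ c>0\,\}.$$
   Context: Self-similar sets: a similitude on $\mathbb{R}^d$ is a map $\varphi(x)=rg(x)+z$ with $0<r<1$, $g\in O(d)$ (orthogonal group), $z\in\mathbb{R}^d$. For a finite family (IFS) $\{\varphi_i\}_{i=1}^m$ of similitudes, the self-similar set generated by it is the unique non-empty compact set $C$ with $C=\varphi_1(C)\cup\dots\cup\varphi_m(C)$. The strong separation condition means that the sets $\varphi_i(C)$, $i=1,\dots,m$, are pairwise disjoint. $\mathcal{H}^s$ is $s$-dimensional Hausdorff measure, $\dim_H$ is Hausdorff dimension, and $\mathcal{H}^s\lfloor_A(B)=\mathcal{H}^s(A\cap B)$. Tangent measures: for a Radon measure $\mu$ on $\mathbb{R}^d$, $a\in\mathbb{R}^d$ and $r>0$, put $\mu_{a,r}(A)=\mu(a+rA)$. A non-zero Radon measure $\nu$ on $\mathbb{R}^d$ is a tangent measure of $\mu$ at $a$ if there are sequences $r_i>0$, $c_i>0$ with $r_i\to0$ and $c_i\mu_{a,r_i}\to\nu$ weakly, i.e. $c_i\int f\,d\mu_{a,r_i}\to\int f\,d\nu$ for all compactly supported continuous $f:\mathbb{R}^d\to\mathbb{R}$. $\operatorname{Tan}(\mu,a)$ is the set of all tangent measures of $\mu$ at $a$. Limit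 models: $\Gamma$ is the set of all closed subsets of $\mathbb{R}^d$ (including $\emptyset$) with the hit-and-miss topology $\rho$ generated by the families $\{F\in\Gamma:F\cap K=\emptyset\}$ ($K$ compact) and $\{F\in\Gamma:F\cap G\neq\emptyset\}$ ($G$ open). Equivalently, $F_n\to F$ in $\rho$ iff (i) every $x\in F$ is the limit of some sequence $x_n\in F_n$, and (ii) for every subsequence $(n_k)$ and every convergent sequence $x_{n_k}\in F_{n_k}$, $\lim_k x_{n_k}\in F$. For a non-empty closed $G$ and $x\in G$, $G^x=\{y-x:y\in G\}$ and $\omega(G^x)=\{F\in\Gamma:\exists\, r_k>0,\ r_k\to0,\ \tfrac1{r_k}G^x\to F \text{ in }\rho\}$. *)

theory Defs
  imports "HOL-Analysis.Analysis"
begin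

text \<open>The size \<open>diam(E)^s\<close>, with \<open>diam({})^s = 0\<close> and \<open>diam(E)^0 = 1\<close> for every non-empty \<open>E\<close>.
  The case \<open>s = 0\<close> is split off because \<open>0 powr 0 = 0\<close>.\<close>

definition diam_pow :: "real \<Rightarrow> 'a::metric_space set \<Rightarrow> ennreal" where
  "diam_pow s E = (if E = {} then 0 else if s = 0 then 1 else ennreal (diameter E powr s))"

text \<open>Boundedness is required explicitly, since \<^const>\<open>diameter\<close> is only meaningful on bounded
  sets. Finite covers are included, because covering sets may be empty.\<close>

definition hausdorff_delta :: "real \<Rightarrow> real \<Rightarrow> 'a::metric_space set \<Rightarrow> ennreal" where
  "hausdorff_delta \<delta> s A =
     (INF E \<in> {E :: nat \<Rightarrow> 'a set. A \<subseteq> (\<Union>i. E i) \<and> (\<forall>i. bounded (E i) \<and> diameter (E i) \<le> \<delta>)}.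
        \<Sum>i. diam_pow s (E i))"

definition hausdorff_outer :: "real \<Rightarrow> 'a::metric_space set \<Rightarrow> ennreal" where
  "hausdorff_outer s A = (SUP \<delta> \<in> {0<..}. hausdorff_delta \<delta> s A)"

definition hausdorff_measure :: "real \<Rightarrow> 'a::metric_space measure" where
  "hausdorff_measure s = measure_of UNIV (sets borel) (hausdorff_outer s)"

text \<open>In a Euclidean space every \<open>s > DIM('a)\<close> belongs to the set below, so the real-valued
  infimum is the usual one.\<close>

definition hausdorff_dim :: "'a::euclidean_space set \<Rightarrow> real" where
  "hausdorff_dim A = Inf {s. 0 \<le> s \<and> hausdorff_outer s A = 0}"

definition measure_restr :: "'a measure \<Rightarrow> 'a set \<Rightarrow> 'a measure" where
  "measure_restr M A = density M (indicator A)"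

text \<open>\<^const>\<open>measure_of\<close> yields the null measure when its last argument is not countably additive.
  The following lemmas exclude this for \<^const>\<open>hausdorff_measure\<close>: Hausdorff outer measure is a
  metric outer measure, hence a measure on the Borel sets.\<close>

lemma diam_pow_empty [simp]: "diam_pow s {} = 0"
  by (simp add: diam_pow_def)

lemma hausdorff_delta_le:
  assumes "A \<subseteq> (\<Union>i. E i)" "\<And>i. bounded (E i)" "\<And>i. diameter (E i) \<le> \<delta>"
  shows "hausdorff_delta \<delta> s A \<le> (\<Sum>i. diam_pow s (E (i::nat)))"
  unfolding hausdorff_delta_def by (rule INF_lower) (use assms in auto)

lemma hausdorff_delta_mono: "A \<subseteq> B \<Longrightarrow> hausdorff_delta \<delta> s A \<le> hausdorff_delta \<delta> s B"
  unfolding hausdorff_delta_def by (rule INF_superset_mono) auto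

lemma hausdorff_delta_antimono: "\<delta> \<le> \<epsilon> \<Longrightarrow> hausdorff_delta \<epsilon> s A \<le> hausdorff_delta \<delta> s A"
  unfolding hausdorff_delta_def by (rule INF_superset_mono) (auto intro: order_trans)

lemma hausdorff_delta_empty:
  assumes "0 < \<delta>" shows "hausdorff_delta \<delta> s {} = 0"
  using hausdorff_delta_le[of "{}" "\<lambda>_. {}" \<delta> s] assms by (auto simp: diameter_def)

lemma hausdorff_delta_UN:
  fixes A :: "nat \<Rightarrow> 'a::metric_space set"
  shows "hausdorff_delta \<delta> s (\<Union>n. A n) \<le> (\<Sum>n. hausdorff_delta \<delta> s (A n))"
proof (rule ennreal_le_epsilon)
  fix e :: real assume fin: "(\<Sum>n. hausdorff_delta \<delta> s (A n)) < top" and e: "0 < e"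
  have finn: "hausdorff_delta \<delta> s (A n) < top" for n
    using fin ennreal_suminf_lessD by blast
  have "\<exists>E. A n \<subseteq> (\<Union>i. E i) \<and> (\<forall>i::nat. bounded (E i) \<and> diameter (E i) \<le> \<delta>) \<and>
      (\<Sum>i. diam_pow s (E i)) < hausdorff_delta \<delta> s (A n) + ennreal (e * (1/2)^Suc n)" for n
  proof -
    have "hausdorff_delta \<delta> s (A n) < hausdorff_delta \<delta> s (A n) + ennreal (e * (1/2)^Suc n)"
      using ennreal_add_left_cancel_less[of "hausdorff_delta \<delta> s (A n)" 0 "ennreal (e * (1/2)^Suc n)"]
        finn[of n] e by auto
    then show ?thesis
      unfolding hausdorff_delta_def[of \<delta> s "A n"] INF_less_iff by auto
  qed
  then obtain E where E: "\<And>n. A n \<subseteq> (\<Union>i. E n i)" "\<And>n (i::nat). bounded (E n i)"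
      "\<And>n i. diameter (E n i) \<le> \<delta>"
      "\<And>n. (\<Sum>i. diam_pow s (E n i)) < hausdorff_delta \<delta> s (A n) + ennreal (e * (1/2)^Suc n)"
    by metis
  define D where "D = (\<lambda>k. case prod_decode k of (n, i) \<Rightarrow> E n i)"
  have sub: "(\<Union>n. A n) \<subseteq> (\<Union>k. D k)"
  proof
    fix x assume "x \<in> (\<Union>n. A n)"
    then obtain n i where "x \<in> E n i" using E(1) by blast
    then have "x \<in> D (prod_encode (n, i))" by (simp add: D_def)
    then show "x \<in> (\<Union>k. D k)" by blast
  qed
  have "hausdorff_delta \<delta> s (\<Union>n. A n) \<le> (\<Sum>k. diam_pow s (D k))"
    by (rule hausdorff_delta_le[OF sub]) (auto simp: D_def E split: prod.split)
  also have "\<dots> = (\<Sum>n. \<Sum>i. diam_pow s (E n i))"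
    using suminf_ennreal_2dimen[of "\<lambda>n. \<Sum>i. diam_pow s (E n i)" "\<lambda>(n, i). diam_pow s (E n i)"]
    by (simp add: D_def comp_def case_prod_unfold)
  also have "\<dots> \<le> (\<Sum>n. hausdorff_delta \<delta> s (A n) + ennreal (e * (1/2)^Suc n))"
    using less_imp_le[OF E(4)] by (intro suminf_le) blast+
  also have "\<dots> = (\<Sum>n. hausdorff_delta \<delta> s (A n)) + (\<Sum>n. ennreal (e * (1/2)^Suc n))"
    by (simp add: suminf_add)
  also have "(\<Sum>n. ennreal (e * (1/2)^Suc n)) = ennreal e"
    using sums_mult[OF power_half_series, of e] e
    by (intro suminf_ennreal_eq) (auto simp: power_divide)
  finally show "hausdorff_delta \<delta> s (\<Union>n. A n) \<le> (\<Sum>n. hausdorff_delta \<delta> s (A n)) + ennreal e" .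
qed

lemma hausdorff_delta_le_outer: "0 < \<delta> \<Longrightarrow> hausdorff_delta \<delta> s A \<le> hausdorff_outer s A"
  unfolding hausdorff_outer_def by (rule SUP_upper) simp

lemma hausdorff_outer_empty [simp]: "hausdorff_outer s {} = 0"
  by (simp add: hausdorff_outer_def hausdorff_delta_empty)

lemma hausdorff_outer_mono: "A \<subseteq> B \<Longrightarrow> hausdorff_outer s A \<le> hausdorff_outer s B"
  unfolding hausdorff_outer_def by (intro SUP_mono) (auto intro: hausdorff_delta_mono)

lemma hausdorff_outer_UN: "hausdorff_outer s (\<Union>n. A n) \<le> (\<Sum>n. hausdorff_outer s (A (n::nat)))"
  unfolding hausdorff_outer_def[of s "\<Union>n. A n"]
  by (intro SUP_least order_trans[OF hausdorff_delta_UN] suminf_le hausdorff_delta_le_outer) auto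

lemma hausdorff_outer_Un: "hausdorff_outer s (A \<union> B) \<le> hausdorff_outer s A + hausdorff_outer s B"
proof -
  have "A \<union> B = (\<Union>n. binaryset A B n)" by (simp add: UN_binaryset_eq)
  then have "hausdorff_outer s (A \<union> B) \<le> (\<Sum>n. hausdorff_outer s (binaryset A B n))"
    using hausdorff_outer_UN[of s "binaryset A B"] by simp
  also have "\<dots> = hausdorff_outer s A + hausdorff_outer s B"
    by (rule suminf_binaryset_eq) simp
  finally show ?thesis .
qed

lemma hausdorff_outer_space: "outer_measure_space UNIV (hausdorff_outer s)"
  unfolding outer_measure_space_def positive_def increasing_def countably_subadditive_def
  by (auto intro: hausdorff_outer_mono hausdorff_outer_UN)

lemma hausdorff_delta_separated:
  fixes A B :: "'a::metric_space set"
  assumes sep: "\<And>x y. x \<in> A \<Longrightarrow> y \<in> B \<Longrightarrow> \<delta> < dist x y"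
  shows "hausdorff_delta \<delta> s A + hausdorff_delta \<delta> s B \<le> hausdorff_delta \<delta> s (A \<union> B)"
  unfolding hausdorff_delta_def[of \<delta> s "A \<union> B"]
proof (rule INF_greatest)
  fix E :: "nat \<Rightarrow> 'a set"
  assume "E \<in> {E. A \<union> B \<subseteq> (\<Union>i. E i) \<and> (\<forall>i. bounded (E i) \<and> diameter (E i) \<le> \<delta>)}"
  then have cov: "A \<union> B \<subseteq> (\<Union>i. E i)" and bd: "\<And>i. bounded (E i)" and dm: "\<And>i. diameter (E i) \<le> \<delta>"
    by auto
  define E1 where "E1 = (\<lambda>i. if E i \<inter> A = {} then {} else E i)"
  define E2 where "E2 = (\<lambda>i. if E i \<inter> A = {} then E i else {})"
  have disj: "E i \<inter> B = {}" if "E i \<inter> A \<noteq> {}" for i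
  proof (rule ccontr)
    assume "E i \<inter> B \<noteq> {}"
    with that obtain x y where "x \<in> E i" "x \<in> A" "y \<in> E i" "y \<in> B" by blast
    then show False
      using sep[of x y] diameter_bounded_bound[OF bd, of x i y] dm[of i] by auto
  qed
  have d: "0 \<le> \<delta>" using dm[of 0] diameter_ge_0[OF bd, of 0] by simp
  have "hausdorff_delta \<delta> s A \<le> (\<Sum>i. diam_pow s (E1 i))"
  proof (rule hausdorff_delta_le)
    show "A \<subseteq> (\<Union>i. E1 i)"
    proof
      fix x assume "x \<in> A"
      moreover from this obtain i where "x \<in> E i" using cov by blast
      ultimately have "x \<in> E1 i" by (auto simp: E1_def)
      then show "x \<in> (\<Union>i. E1 i)" by blast
    qed
  qed (use bd dm d in \<open>simp_all add: E1_def\<close>)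
  moreover have "hausdorff_delta \<delta> s B \<le> (\<Sum>i. diam_pow s (E2 i))"
  proof (rule hausdorff_delta_le)
    show "B \<subseteq> (\<Union>i. E2 i)"
    proof
      fix x assume "x \<in> B"
      moreover from this obtain i where "x \<in> E i" using cov by blast
      ultimately have "x \<in> E2 i" using disj[of i] by (auto simp: E2_def)
      then show "x \<in> (\<Union>i. E2 i)" by blast
    qed
  qed (use bd dm d in \<open>simp_all add: E2_def\<close>)
  moreover have "(\<Sum>i. diam_pow s (E1 i)) + (\<Sum>i. diam_pow s (E2 i)) = (\<Sum>i. diam_pow s (E i))"
    unfolding suminf_add[OF summableI summableI]
    by (intro arg_cong[where f = suminf] ext) (auto simp: E1_def E2_def)
  ultimately show "hausdorff_delta \<delta> s A + hausdorff_delta \<delta> s B \<le> (\<Sum>i. diam_pow s (E i))"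
    by (metis add_mono)
qed

lemma hausdorff_outer_separated:
  fixes A B :: "'a::metric_space set"
  assumes e: "0 < e" and sep: "\<And>x y. x \<in> A \<Longrightarrow> y \<in> B \<Longrightarrow> e \<le> dist x y"
  shows "hausdorff_outer s A + hausdorff_outer s B \<le> hausdorff_outer s (A \<union> B)"
proof -
  have *: "hausdorff_delta d1 s A + hausdorff_delta d2 s B \<le> hausdorff_outer s (A \<union> B)"
    if "0 < d1" "0 < d2" for d1 d2
  proof -
    define d where "d = min (min d1 d2) (e/2)"
    have d: "0 < d" "d \<le> d1" "d \<le> d2" "d < e" using that e by (auto simp: d_def)
    have "hausdorff_delta d1 s A + hausdorff_delta d2 s B \<le> hausdorff_delta d s A + hausdorff_delta d s B"
      using d by (intro add_mono hausdorff_delta_antimono)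
    also have "\<dots> \<le> hausdorff_delta d s (A \<union> B)"
      using d sep by (intro hausdorff_delta_separated) fastforce
    also have "\<dots> \<le> hausdorff_outer s (A \<union> B)" using d by (intro hausdorff_delta_le_outer)
    finally show ?thesis .
  qed
  have ne: "{0::real<..} \<noteq> {}" using greaterThan_non_empty by blast
  have "hausdorff_outer s A + hausdorff_delta d2 s B \<le> hausdorff_outer s (A \<union> B)" if "0 < d2" for d2
    unfolding hausdorff_outer_def[of s A] ennreal_SUP_add_left[OF ne, symmetric]
    by (rule SUP_least) (use * that in auto)
  then show ?thesis
    unfolding hausdorff_outer_def[of s B] ennreal_SUP_add_right[OF ne, of "hausdorff_outer s A"]
    by (intro SUP_least) auto
qed

lemma hausdorff_outer_caratheodory:
  fixes K A :: "'a::metric_space set"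
  assumes K: "closed K"
  shows "hausdorff_outer s (A \<inter> K) + hausdorff_outer s (A - K) \<le> hausdorff_outer s A"
proof (cases "K = {} \<or> hausdorff_outer s A = top")
  case True
  then show ?thesis by auto
next
  case False
  then have ne: "K \<noteq> {}" and fin: "hausdorff_outer s A < top" by (auto simp: less_top)
  let ?H = "hausdorff_outer s"
  define t where "t = (\<lambda>n::nat. 1 / real (n + 1))"
  define R where "R = (\<lambda>n. {x \<in> A. t (n + 1) \<le> infdist x K \<and> infdist x K < t n})"
  define S where "S = (\<lambda>n. {x \<in> A. t n \<le> infdist x K})"
  have t_less: "t n < t m" if "m < n" for m n using that by (simp add: t_def frac_less2)
  have t_le: "t n \<le> t m" if "m \<le> n" for m n using that t_less[of m n] by (cases "m = n") auto
  have t_pos: "0 < t n" for n by (simp add: t_def)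
  have lip: "\<bar>infdist x K - infdist y K\<bar> \<le> dist x y" for x y
    by (rule infdist_triangle_abs)
  have Sn: "?H (A \<inter> K) + ?H (S n) \<le> ?H A" for n
  proof -
    have "?H (A \<inter> K) + ?H (S n) \<le> ?H ((A \<inter> K) \<union> S n)"
    proof (rule hausdorff_outer_separated[OF t_pos[of n]])
      fix x y assume "x \<in> A \<inter> K" "y \<in> S n"
      then show "t n \<le> dist x y" using lip[of x y] by (auto simp: S_def)
    qed
    also have "\<dots> \<le> ?H A" by (rule hausdorff_outer_mono) (auto simp: S_def)
    finally show ?thesis .
  qed
  have parity: "(\<Sum>k<n. ?H (R (2 * k + p))) \<le> ?H (\<Union>k<n. R (2 * k + p))" for n p
  proof (induction n)
    case (Suc n)
    have "(\<Sum>k<Suc n. ?H (R (2 * k + p))) \<le> ?H (\<Union>k<n. R (2 * k + p)) + ?H (R (2 * n + p))"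
      using Suc by (simp add: add_right_mono)
    also have "\<dots> \<le> ?H ((\<Union>k<n. R (2 * k + p)) \<union> R (2 * n + p))"
    proof (cases "n = 0")
      case False
      show ?thesis
      proof (rule hausdorff_outer_separated)
        show "0 < t (2 * n + p - 1) - t (2 * n + p)" using False t_less by simp
        fix x y assume "x \<in> (\<Union>k<n. R (2 * k + p))" and y: "y \<in> R (2 * n + p)"
        then obtain k where k: "k < n" "x \<in> R (2 * k + p)" by auto
        then have "t (2 * n + p - 1) \<le> infdist x K"
          using t_le[of "2 * k + p + 1" "2 * n + p - 1"] by (force simp: R_def)
        then show "t (2 * n + p - 1) - t (2 * n + p) \<le> dist x y"
          using y lip[of x y] by (auto simp: R_def)
      qed
    qed simp
    also have "(\<Union>k<n. R (2 * k + p)) \<union> R (2 * n + p) = (\<Union>k<Suc n. R (2 * k + p))"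
      by (auto simp: lessThan_Suc)
    finally show ?case .
  qed simp
  have RA: "?H (\<Union>i\<in>I. R (f i)) \<le> ?H A" for I and f :: "nat \<Rightarrow> nat"
    by (rule hausdorff_outer_mono) (auto simp: R_def)
  define h where "h = (\<lambda>i. enn2real (?H (R i)))"
  have HR: "?H (R i) = ennreal (h i)" for i
  proof -
    have "?H (R i) \<le> ?H A" by (rule hausdorff_outer_mono) (auto simp: R_def)
    then show ?thesis unfolding h_def using fin by (simp add: le_less_trans)
  qed
  have h0: "0 \<le> h i" for i by (simp add: h_def)
  have sumh: "summable h"
  proof (rule bounded_imp_summable)
    fix n
    have sp: "{..n} \<subseteq> (\<lambda>k. 2 * k) ` {..<Suc n} \<union> (\<lambda>k. 2 * k + 1) ` {..<Suc n}"
    proof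
      fix i assume "i \<in> {..n}"
      then have "i = 2 * (i div 2) \<or> i = 2 * (i div 2) + 1" "i div 2 < Suc n" by auto
      then show "i \<in> (\<lambda>k. 2 * k) ` {..<Suc n} \<union> (\<lambda>k. 2 * k + 1) ` {..<Suc n}" by blast
    qed
    have "(\<Sum>i\<le>n. h i) \<le> sum h ((\<lambda>k. 2 * k) ` {..<Suc n} \<union> (\<lambda>k. 2 * k + 1) ` {..<Suc n})"
      by (rule sum_mono2[OF _ sp]) (auto simp: h0)
    also have "\<dots> \<le> sum h ((\<lambda>k. 2 * k) ` {..<Suc n}) + sum h ((\<lambda>k. 2 * k + 1) ` {..<Suc n})"
      by (subst sum.union_inter[symmetric]) (auto intro!: sum_nonneg h0)
    also have "\<dots> = (\<Sum>k<Suc n. h (2 * k + 0)) + (\<Sum>k<Suc n. h (2 * k + 1))"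
      by (simp add: sum.reindex inj_on_def del: sum.lessThan_Suc)
    finally have "ennreal (\<Sum>i\<le>n. h i)
        \<le> (\<Sum>k<Suc n. ?H (R (2 * k + 0))) + (\<Sum>k<Suc n. ?H (R (2 * k + 1)))"
      unfolding HR by (simp add: sum_ennreal h0 sum_nonneg ennreal_plus[symmetric]
          ennreal_leI del: sum.lessThan_Suc ennreal_plus)
    also have "\<dots> \<le> ?H A + ?H A"
      by (intro add_mono order_trans[OF parity] RA)
    also have "\<dots> = ennreal (enn2real (?H A) + enn2real (?H A))"
      using fin by (subst ennreal_plus) auto
    finally show "(\<Sum>i\<le>n. h i) \<le> enn2real (?H A) + enn2real (?H A)"
      by (simp add: ennreal_le_iff)
  qed (rule h0)
  show ?thesis
  proof (rule ennreal_le_epsilon)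
    fix e :: real assume "0 < e"
    then obtain n where n: "norm (\<Sum>i. h (i + n)) < e"
      using suminf_exist_split[OF _ sumh, of e] by blast
    have "A - K \<subseteq> S n \<union> (\<Union>i. R (i + n))"
    proof
      fix x assume x: "x \<in> A - K"
      then have pos: "0 < infdist x K"
        using ne K in_closed_iff_infdist_zero[of K x] infdist_nonneg[of x K] by force
      show "x \<in> S n \<union> (\<Union>i. R (i + n))"
      proof (cases "t n \<le> infdist x K")
        case True
        then show ?thesis using x by (simp add: S_def)
      next
        case False
        obtain m where "inverse (real (Suc m)) < infdist x K"
          using reals_Archimedean[OF pos] by blast
        then have ex: "t m \<le> infdist x K" by (simp add: t_def inverse_eq_divide)
        define q where "q = (LEAST m. t m \<le> infdist x K)"
        have q: "t q \<le> infdist x K" unfolding q_def using ex by (rule LeastI)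
        have qn: "n < q" using q False t_le[of q n] by force
        have "\<not> t (q - 1) \<le> infdist x K"
          using not_less_Least[of "q - 1" "\<lambda>m. t m \<le> infdist x K"] qn unfolding q_def[symmetric] by simp
        then have "x \<in> R ((q - 1 - n) + n)" using q qn x by (simp add: R_def)
        then show ?thesis by blast
      qed
    qed
    then have "?H (A - K) \<le> ?H (S n) + ?H (\<Union>i. R (i + n))"
      by (meson hausdorff_outer_mono hausdorff_outer_Un order_trans)
    also have "?H (\<Union>i. R (i + n)) \<le> (\<Sum>i. ?H (R (i + n)))" by (rule hausdorff_outer_UN)
    also have "\<dots> = ennreal (\<Sum>i. h (i + n))"
      unfolding HR using sumh h0 by (intro suminf_ennreal2) (auto simp: summable_iff_shift)
    also have "\<dots> \<le> ennreal e" using n by (intro ennreal_leI) auto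
    finally have "?H (A - K) \<le> ?H (S n) + ennreal e" by (simp add: add_left_mono)
    then have "?H (A \<inter> K) + ?H (A - K) \<le> (?H (A \<inter> K) + ?H (S n)) + ennreal e"
      by (simp add: add_left_mono add.assoc)
    also have "\<dots> \<le> ?H A + ennreal e" using Sn by (rule add_right_mono)
    finally show "?H (A \<inter> K) + ?H (A - K) \<le> ?H A + ennreal e" .
  qed
qed

lemma measure_space_hausdorff_outer:
  "measure_space UNIV (sets (borel :: 'a::metric_space measure)) (hausdorff_outer s)"
proof -
  interpret P: sigma_algebra "UNIV :: 'a set" UNIV
    using sigma_algebra_Pow[of "UNIV :: 'a set"] by simp
  let ?L = "lambda_system (UNIV :: 'a set) UNIV (hausdorff_outer s)"
  have ms: "measure_space UNIV ?L (hausdorff_outer s)"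
    by (rule P.caratheodory_lemma[OF hausdorff_outer_space])
  then interpret L: sigma_algebra UNIV ?L by (simp add: measure_space_def)
  have "closed K \<Longrightarrow> K \<in> ?L" for K
    unfolding P.lambda_system_eq
    using hausdorff_outer_caratheodory[of K s] hausdorff_outer_Un[of s "x \<inter> K" "x - K" for x]
    by (auto intro!: antisym simp: Int_Diff_Un)
  then have "sigma_sets UNIV (Collect closed) \<subseteq> ?L"
    by (intro L.sigma_sets_subset) auto
  then have "sets (borel :: 'a measure) \<subseteq> ?L"
    by (simp add: borel_eq_closed)
  then show ?thesis
    using ms sets.sigma_algebra_axioms[of "borel :: 'a measure"] measure_down by fastforce
qed

lemma sets_hausdorff_measure [simp, measurable_cong]: "sets (hausdorff_measure s) = sets borel"
  unfolding hausdorff_measure_def by (metis sets.sets_measure_of_eq space_borel)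

lemma emeasure_hausdorff_measure:
  "A \<in> sets borel \<Longrightarrow> emeasure (hausdorff_measure s) A = hausdorff_outer s A"
  unfolding hausdorff_measure_def
  using measure_space_hausdorff_outer[of s]
  by (intro emeasure_measure_of_sigma) (auto simp: measure_space_def)

lemma emeasure_measure_restr_hausdorff:
  assumes "A \<in> sets borel" "B \<in> sets borel"
  shows "emeasure (measure_restr (hausdorff_measure s) A) B = hausdorff_outer s (A \<inter> B)"
  using assms by (simp add: measure_restr_def emeasure_restricted emeasure_hausdorff_measure)

definition similitude :: "('a::euclidean_space \<Rightarrow> 'a) \<Rightarrow> bool" where
  "similitude \<phi> \<longleftrightarrow>
     (\<exists>r g z. 0 < r \<and> r < 1 \<and> orthogonal_transformation g \<and> (\<forall>x. \<phi> x = r *\<^sub>R g x + z))"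

definition self_similar_set :: "nat \<Rightarrow> (nat \<Rightarrow> 'a::euclidean_space \<Rightarrow> 'a) \<Rightarrow> 'a set \<Rightarrow> bool" where
  "self_similar_set m \<phi> C \<longleftrightarrow>
     (\<forall>i\<in>{1..m}. similitude (\<phi> i)) \<and> compact C \<and> C \<noteq> {} \<and> C = (\<Union>i\<in>{1..m}. \<phi> i ` C)"

definition strong_separation :: "nat \<Rightarrow> (nat \<Rightarrow> 'a \<Rightarrow> 'a) \<Rightarrow> 'a set \<Rightarrow> bool" where
  "strong_separation m \<phi> C \<longleftrightarrow> disjoint_family_on (\<lambda>i. \<phi> i ` C) {1..m}"

definition radon_measure :: "'a::euclidean_space measure \<Rightarrow> bool" where
  "radon_measure \<nu> \<longleftrightarrow>
     sets \<nu> = sets borel \<and>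
     (\<forall>K. compact K \<longrightarrow> emeasure \<nu> K < \<infinity>) \<and>
     (\<forall>U. open U \<longrightarrow> emeasure \<nu> U = (SUP K \<in> {K. compact K \<and> K \<subseteq> U}. emeasure \<nu> K)) \<and>
     (\<forall>A\<in>sets borel. emeasure \<nu> A = (INF U \<in> {U. open U \<and> A \<subseteq> U}. emeasure \<nu> U))"

definition blow_up :: "'a::euclidean_space measure \<Rightarrow> 'a \<Rightarrow> real \<Rightarrow> 'a measure" where
  "blow_up \<mu> a r = distr \<mu> borel (\<lambda>y. (y - a) /\<^sub>R r)"

lemma emeasure_blow_up:
  assumes "sets \<mu> = sets borel" "0 < r" "A \<in> sets borel"
  shows "emeasure (blow_up \<mu> a r) A = emeasure \<mu> ((\<lambda>y. a + r *\<^sub>R y) ` A)"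
proof -
  have meas: "(\<lambda>y. (y - a) /\<^sub>R r) \<in> measurable \<mu> borel"
    unfolding measurable_cong_sets[OF assms(1) refl] by measurable
  have "(\<lambda>y. (y - a) /\<^sub>R r) -` A = (\<lambda>y. a + r *\<^sub>R y) ` A"
  proof (intro set_eqI iffI)
    fix y assume "y \<in> (\<lambda>y. (y - a) /\<^sub>R r) -` A"
    then show "y \<in> (\<lambda>y. a + r *\<^sub>R y) ` A"
      using assms(2) by (intro image_eqI[of _ _ "(y - a) /\<^sub>R r"]) auto
  qed (use assms(2) in auto)
  moreover have "space \<mu> = UNIV" using sets_eq_imp_space_eq[OF assms(1)] by simp
  ultimately show ?thesis
    unfolding blow_up_def by (simp add: emeasure_distr[OF meas assms(3)])
qed

definition tangent_measures :: "'a::euclidean_space measure \<Rightarrow> 'a \<Rightarrow> 'a measure set" where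
  "tangent_measures \<mu> a =
     {\<nu>. radon_measure \<nu> \<and> emeasure \<nu> UNIV \<noteq> 0 \<and>
         (\<exists>r c :: nat \<Rightarrow> real. (\<forall>i. 0 < r i) \<and> (\<forall>i. 0 < c i) \<and> r \<longlonglongrightarrow> 0 \<and>
            (\<forall>f :: 'a \<Rightarrow> real. continuous_on UNIV f \<and> compact (closure {y. f y \<noteq> 0}) \<longrightarrow>
               (\<lambda>i. c i * (\<integral>y. f y \<partial>(blow_up \<mu> a (r i)))) \<longlonglongrightarrow> (\<integral>y. f y \<partial>\<nu>)))}"

definition hit_miss_topology :: "'a::euclidean_space set topology" where
  "hit_miss_topology =
     topology_generated_by
       ({{F. closed F \<and> F \<inter> K = {}} |K. compact K} \<union> {{F. closed F \<and> F \<inter> G \<noteq> {}} |G. open G})"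

lemma topspace_hit_miss_topology: "topspace hit_miss_topology = {F. closed F}"
proof -
  have "{F :: 'a set. closed F} = {F. closed F \<and> F \<inter> {} = {}}" by simp
  then have "{F :: 'a set. closed F} \<in> {{F. closed F \<and> F \<inter> K = {}} |K. compact K}"
    using compact_empty by blast
  then show ?thesis
    unfolding hit_miss_topology_def topology_generated_by_topspace by blast
qed

definition recenter :: "'a::euclidean_space set \<Rightarrow> 'a \<Rightarrow> 'a set" where
  "recenter G x = (\<lambda>y. y - x) ` G"

definition limit_models :: "'a::euclidean_space set \<Rightarrow> 'a set set" where
  "limit_models H =
     {F. \<exists>r :: nat \<Rightarrow> real. (\<forall>k. 0 < r k) \<and> r \<longlonglongrightarrow> 0 \<and>
           limitin hit_miss_topology (\<lambda>k. (\<lambda>y. (1 / r k) *\<^sub>R y) ` H) F sequentially}"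

end

theory Submission
  imports Defs "HOL-Complex_Analysis.Great_Picard" "HOL-Library.Diagonal_Subsequence"
begin

text \<open>By strong separation, a small ball around a point of \<open>C\<close> meets \<open>C\<close> only in one cylinder set of
  comparable size. So on a fixed ball the magnifications \<open>(C - x) / r\<close> are similar copies of \<open>C\<close>
  whose ratios stay in a compact interval, and along a subsequence the similarities converge uniformly
  on \<open>C\<close>. Their limit describes both the limit set \<open>F\<close> and, because \<open>H\<^sup>s\<close> scales under similarities
  and \<open>0 < H\<^sup>s(C) < \<infinity>\<close>, the limit of the restricted measures. Hence \<open>(C - x) / r\<^sub>k \<rightarrow> F\<close> implies that
  \<open>H\<^sup>s\<close> restricted to \<open>(C - x) / r\<^sub>k\<close> converges weakly to \<open>H\<^sup>s\<close> restricted to \<open>F\<close>, which is one inclusion.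
  The other one follows because the hit-and-miss topology is sequentially compact and because the
  normalising constants of a convergent sequence of blow-ups are then forced to converge.\<close>

section \<open>Hausdorff measure and similarities\<close>

text \<open>The limiting similarity depends on the ball and on the subsequence, and \<open>F\<close>
  as a whole need not be one copy of \<open>C\<close>. That H^s(C) is finite and positive rests on
  Moran's equation, the sum of the \<open>q i powr s\<close> being 1. Iterating the decomposition of
  \<open>C\<close> keeps the sum of the s-th powers of the sizes constant, which bounds H^s(C) from
  above; the gap \<delta> between the pieces turns the same bookkeeping into a lower bound. Only
  then is this exponent identified with the dimension. In the converse inclusion the constants are
  recovered by dividing by the integral of one test function. This requires H^s on \<open>F\<close>
  to be non-zero, which comes from 0 being in \<open>F\<close> and from the positive measure of
  every ball centred in \<open>C\<close>.\<close>

text \<open>The condition is relative to \<open>S\<close> because the limit maps produced later by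
  Arzela-Ascoli are controlled on \<open>C\<close> only.\<close>

definition similarity_on :: "real \<Rightarrow> 'a::metric_space set \<Rightarrow> ('a \<Rightarrow> 'b::metric_space) \<Rightarrow> bool" where
  "similarity_on r S f \<longleftrightarrow> 0 < r \<and> (\<forall>x\<in>S. \<forall>y\<in>S. dist (f x) (f y) = r * dist x y)"

lemma similarity_on_subset: "similarity_on r T f \<Longrightarrow> S \<subseteq> T \<Longrightarrow> similarity_on r S f"
  by (auto simp: similarity_on_def)

lemma similarity_on_comp:
  "similarity_on r UNIV f \<Longrightarrow> similarity_on t UNIV g \<Longrightarrow> similarity_on (r * t) UNIV (f \<circ> g)"
  by (auto simp: similarity_on_def)

lemma similarity_on_continuous: "similarity_on r S f \<Longrightarrow> continuous_on S f"
  by (rule lipschitz_on_continuous_on[of r])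
    (auto simp: similarity_on_def intro!: lipschitz_onI)

lemma similarity_on_inj: "similarity_on r S f \<Longrightarrow> inj_on f S"
  by (auto simp: similarity_on_def inj_on_def) (metis dist_eq_0_iff mult_eq_0_iff less_irrefl)

lemma similarity_on_inv_into:
  assumes "similarity_on r S f"
  shows "similarity_on (1 / r) (f ` S) (inv_into S f)"
  using assms similarity_on_inj[OF assms]
  by (auto simp: similarity_on_def)

lemma diam_pow_image_le:
  assumes lip: "\<And>x y. x \<in> E \<Longrightarrow> y \<in> E \<Longrightarrow> dist (f x) (f y) \<le> r * dist x y"
    and r: "0 < r" and bd: "bounded E" and s: "0 \<le> s"
  shows "bounded (f ` E)" "diameter (f ` E) \<le> r * diameter E"
    "diam_pow s (f ` E) \<le> ennreal (r powr s) * diam_pow s E"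
proof -
  have *: "dist u v \<le> r * diameter E" if uv: "u \<in> f ` E" "v \<in> f ` E" for u v
  proof -
    obtain x y where xy: "x \<in> E" "y \<in> E" "u = f x" "v = f y" using uv by blast
    have "dist u v \<le> r * dist x y" using xy lip by simp
    also have "\<dots> \<le> r * diameter E"
      using xy bd r by (intro mult_left_mono diameter_bounded_bound) auto
    finally show ?thesis .
  qed
  show bd': "bounded (f ` E)"
    using * unfolding bounded_two_points by blast
  show d: "diameter (f ` E) \<le> r * diameter E"
    using * diameter_ge_0[OF bd] r
    by (cases "E = {}") (auto simp: diameter_def intro!: cSUP_least)
  show "diam_pow s (f ` E) \<le> ennreal (r powr s) * diam_pow s E"
  proof -
    have "diameter (f ` E) powr s \<le> r powr s * diameter E powr s"
      using d r s diameter_ge_0[OF bd] diameter_ge_0[OF bd']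
      by (subst powr_mult[symmetric]) (auto intro!: powr_mono2)
    then show ?thesis
      using r by (auto simp: diam_pow_def ennreal_mult[symmetric] intro: ennreal_leI)
  qed
qed

lemma hausdorff_delta_image_le:
  assumes lip: "\<And>x y. x \<in> A \<Longrightarrow> y \<in> A \<Longrightarrow> dist (f x) (f y) \<le> r * dist x y"
    and r: "0 < r" and s: "0 \<le> s"
  shows "hausdorff_delta (r * \<delta>) s (f ` A) \<le> ennreal (r powr s) * hausdorff_delta \<delta> s A"
proof -
  \<comment> \<open>With the constant on the left, the right-hand side is a bare infimum and each
    cover can be treated separately.\<close>
  have "ennreal (1 / r powr s) * hausdorff_delta (r * \<delta>) s (f ` A) \<le> hausdorff_delta \<delta> s A"
    unfolding hausdorff_delta_def[of \<delta> s A]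
  proof (rule INF_greatest)
    fix E :: "nat \<Rightarrow> 'a set"
    assume "E \<in> {E. A \<subseteq> (\<Union>i. E i) \<and> (\<forall>i. bounded (E i) \<and> diameter (E i) \<le> \<delta>)}"
    then have cov: "A \<subseteq> (\<Union>i. E i)" and bd: "\<And>i. bounded (E i)"
      and dm: "\<And>i. diameter (E i) \<le> \<delta>" by auto
    \<comment> \<open>\<open>f\<close> is Lipschitz only on \<open>A\<close>, so the covering sets
      are cut down to \<open>A\<close> before they are mapped.\<close>
    let ?D = "\<lambda>i. E i \<inter> A"
    have bdD: "bounded (?D i)" for i using bd by (simp add: bounded_Int)
    have dmD: "diameter (?D i) \<le> diameter (E i)" for i
      by (rule diameter_subset) (use bd in auto)
    note im = diam_pow_image_le[of "?D i" f r s for i, OF _ r bdD s]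
    have "hausdorff_delta (r * \<delta>) s (f ` A) \<le> (\<Sum>i. diam_pow s (f ` ?D i))"
    proof (rule hausdorff_delta_le)
      show "f ` A \<subseteq> (\<Union>i. f ` ?D i)" using cov by blast
      show "bounded (f ` ?D i)" for i using im(1) lip by auto
      have "r * diameter (?D i) \<le> r * \<delta>" for i
        using dmD[of i] dm[of i] r by (intro mult_left_mono) auto
      then show "diameter (f ` ?D i) \<le> r * \<delta>" for i
        using im(2)[of i] lip by (meson IntD2 order_trans)
    qed
    also have "\<dots> \<le> (\<Sum>i. ennreal (r powr s) * diam_pow s (E i))"
    proof (rule suminf_le)
      fix i
      have "diam_pow s (?D i) \<le> diam_pow s (E i)"
        using dmD[of i] s diameter_ge_0[OF bdD]
        by (auto simp: diam_pow_def intro!: ennreal_leI powr_mono2)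
      then have "ennreal (r powr s) * diam_pow s (?D i) \<le> ennreal (r powr s) * diam_pow s (E i)"
        by (rule mult_left_mono) simp
      then show "diam_pow s (f ` ?D i) \<le> ennreal (r powr s) * diam_pow s (E i)"
        using im(3)[of i] lip by (meson IntD2 order_trans)
    qed auto
    also have "\<dots> = ennreal (r powr s) * (\<Sum>i. diam_pow s (E i))"
      by (rule ennreal_suminf_cmult)
    finally have "ennreal (1 / r powr s) * hausdorff_delta (r * \<delta>) s (f ` A)
        \<le> ennreal (1 / r powr s) * (ennreal (r powr s) * (\<Sum>i. diam_pow s (E i)))"
      by (rule mult_left_mono) simp
    also have "\<dots> = (\<Sum>i. diam_pow s (E i))"
      using r by (simp add: mult.assoc[symmetric] ennreal_mult[symmetric])
    finally show "ennreal (1 / r powr s) * hausdorff_delta (r * \<delta>) s (f ` A)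
        \<le> (\<Sum>i. diam_pow s (E i))" .
  qed
  then have "ennreal (r powr s) * (ennreal (1 / r powr s) * hausdorff_delta (r * \<delta>) s (f ` A))
      \<le> ennreal (r powr s) * hausdorff_delta \<delta> s A"
    by (rule mult_left_mono) simp
  then show ?thesis
    using r by (simp add: mult.assoc[symmetric] ennreal_mult[symmetric])
qed

lemma hausdorff_outer_lipschitz_image_le:
  assumes lip: "\<And>x y. x \<in> A \<Longrightarrow> y \<in> A \<Longrightarrow> dist (f x) (f y) \<le> r * dist x y"
    and r: "0 < r" and s: "0 \<le> s"
  shows "hausdorff_outer s (f ` A) \<le> ennreal (r powr s) * hausdorff_outer s A"
  unfolding hausdorff_outer_def[of s "f ` A"]
proof (rule SUP_least)
  fix \<delta> :: real assume "\<delta> \<in> {0<..}"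
  then have \<delta>: "0 < \<delta> / r" using r by simp
  have "hausdorff_delta \<delta> s (f ` A) \<le> ennreal (r powr s) * hausdorff_delta (\<delta> / r) s A"
    using hausdorff_delta_image_le[of A f r s "\<delta> / r", OF lip r s] r by simp
  also have "\<dots> \<le> ennreal (r powr s) * hausdorff_outer s A"
    by (intro mult_left_mono hausdorff_delta_le_outer \<delta>) simp
  finally show "hausdorff_delta \<delta> s (f ` A) \<le> ennreal (r powr s) * hausdorff_outer s A" .
qed

text \<open>The Lipschitz estimate is applied twice, to \<open>f\<close> with constant
  \<open>r\<close> and to its inverse on the image with constant \<open>1 / r\<close>. Since this
  concerns the outer measure, it holds for arbitrary sets.\<close>

lemma hausdorff_outer_similarity_image:
  assumes f: "similarity_on r A f" and s: "0 \<le> s"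
  shows "hausdorff_outer s (f ` A) = ennreal (r powr s) * hausdorff_outer s A"
proof (rule antisym)
  have r: "0 < r" using f by (simp add: similarity_on_def)
  show "hausdorff_outer s (f ` A) \<le> ennreal (r powr s) * hausdorff_outer s A"
    by (rule hausdorff_outer_lipschitz_image_le[OF _ r s])
      (use f in \<open>auto simp: similarity_on_def\<close>)
  have "hausdorff_outer s (inv_into A f ` f ` A)
      \<le> ennreal ((1 / r) powr s) * hausdorff_outer s (f ` A)"
    by (rule hausdorff_outer_lipschitz_image_le[OF _ _ s])
      (use similarity_on_inv_into[OF f] in \<open>auto simp: similarity_on_def\<close>)
  then have "hausdorff_outer s A \<le> ennreal ((1 / r) powr s) * hausdorff_outer s (f ` A)"
    using similarity_on_inj[OF f] by simp
  then have "ennreal (r powr s) * hausdorff_outer s A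
      \<le> ennreal (r powr s) * (ennreal ((1 / r) powr s) * hausdorff_outer s (f ` A))"
    by (rule mult_left_mono) simp
  also have "\<dots> = hausdorff_outer s (f ` A)"
    using r by (simp add: mult.assoc[symmetric] ennreal_mult[symmetric] powr_divide)
  finally show "ennreal (r powr s) * hausdorff_outer s A \<le> hausdorff_outer s (f ` A)" .
qed

section \<open>Dependence on the exponent and Hausdorff dimension\<close>

lemma diam_pow_exponent_le:
  assumes "0 \<le> p" "p < q" "0 < \<delta>" "bounded E" "diameter E \<le> \<delta>"
  shows "diam_pow q E \<le> ennreal (\<delta> powr (q - p)) * diam_pow p E"
proof -
  have d: "0 \<le> diameter E" using assms(4) by (rule diameter_ge_0)
  \<comment> \<open>This bound serves the case \<open>p = 0\<close>, where
    \<open>diam_pow p E\<close> is 1 even for sets of diameter 0.\<close>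
  have "diameter E powr q \<le> \<delta> powr q"
    using assms d by (intro powr_mono2) auto
  moreover have "diameter E powr q \<le> \<delta> powr (q - p) * diameter E powr p"
  proof -
    have "diameter E powr q = diameter E powr (q - p) * diameter E powr p"
      by (simp add: powr_add[symmetric])
    also have "\<dots> \<le> \<delta> powr (q - p) * diameter E powr p"
      using assms d by (intro mult_right_mono powr_mono2) auto
    finally show ?thesis .
  qed
  ultimately show ?thesis
    using assms by (auto simp: diam_pow_def ennreal_mult[symmetric] intro: ennreal_leI)
qed

lemma hausdorff_delta_exponent_le:
  assumes "0 \<le> p" "p < q" "0 < \<delta>"
  shows "hausdorff_delta \<delta> q A \<le> ennreal (\<delta> powr (q - p)) * hausdorff_delta \<delta> p A"
proof -
  let ?c = "\<delta> powr (q - p)"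
  have "ennreal (1 / ?c) * hausdorff_delta \<delta> q A \<le> hausdorff_delta \<delta> p A"
    unfolding hausdorff_delta_def[of \<delta> p A]
  proof (rule INF_greatest)
    fix E :: "nat \<Rightarrow> 'a set"
    assume "E \<in> {E. A \<subseteq> (\<Union>i. E i) \<and> (\<forall>i. bounded (E i) \<and> diameter (E i) \<le> \<delta>)}"
    then have E: "A \<subseteq> (\<Union>i. E i)" "\<And>i. bounded (E i)" "\<And>i. diameter (E i) \<le> \<delta>" by auto
    have "hausdorff_delta \<delta> q A \<le> (\<Sum>i. diam_pow q (E i))"
      using E by (rule hausdorff_delta_le)
    also have "\<dots> \<le> (\<Sum>i. ennreal ?c * diam_pow p (E i))"
      by (intro suminf_le diam_pow_exponent_le assms E) auto
    also have "\<dots> = ennreal ?c * (\<Sum>i. diam_pow p (E i))"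
      by (rule ennreal_suminf_cmult)
    finally have "ennreal (1 / ?c) * hausdorff_delta \<delta> q A
        \<le> ennreal (1 / ?c) * (ennreal ?c * (\<Sum>i. diam_pow p (E i)))"
      by (rule mult_left_mono) simp
    then show "ennreal (1 / ?c) * hausdorff_delta \<delta> q A \<le> (\<Sum>i. diam_pow p (E i))"
      using assms by (simp add: mult.assoc[symmetric] ennreal_mult[symmetric])
  qed
  then have "ennreal ?c * (ennreal (1 / ?c) * hausdorff_delta \<delta> q A)
      \<le> ennreal ?c * hausdorff_delta \<delta> p A"
    by (rule mult_left_mono) simp
  then show ?thesis
    using assms by (simp add: mult.assoc[symmetric] ennreal_mult[symmetric])
qed

text \<open>Raising the exponent from \<open>p\<close> to \<open>q\<close> gains the factor
  \<open>\<delta> powr (q - p)\<close> at mesh \<delta>, and this tends to 0 while the outer measure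
  for \<open>p\<close> stays bounded.\<close>

lemma hausdorff_outer_eq_0_exponent_mono:
  assumes p: "0 \<le> p" and pq: "p < q" and fin: "hausdorff_outer p A < \<infinity>"
  shows "hausdorff_outer q A = 0"
proof -
  obtain h where h: "hausdorff_outer p A = ennreal h" "0 \<le> h"
    using fin by (cases "hausdorff_outer p A") auto
  have "hausdorff_delta \<epsilon> q A \<le> 0" if \<epsilon>: "0 < \<epsilon>" for \<epsilon>
  proof (rule ennreal_le_epsilon)
    fix e :: real assume e: "0 < e"
    have "((\<lambda>\<delta>. \<delta> powr (q - p) * h) \<longlongrightarrow> 0 powr (q - p) * h) (at_right 0)"
      using pq by (intro tendsto_intros tendsto_powr') (auto simp: eventually_at_filter)
    then have "\<forall>\<^sub>F \<delta> in at_right 0. \<delta> powr (q - p) * h < e"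
      using e pq by (auto dest: order_tendstoD(2))
    then have "\<forall>\<^sub>F \<delta> in at_right 0. \<delta> powr (q - p) * h < e \<and> 0 < \<delta> \<and> \<delta> < \<epsilon>"
      using eventually_at_right_real[OF \<epsilon>] by eventually_elim auto
    then obtain \<delta> where \<delta>: "\<delta> powr (q - p) * h < e" "0 < \<delta>" "\<delta> < \<epsilon>"
      by (rule eventually_happens'[rotated, THEN exE]) auto
    have "hausdorff_delta \<epsilon> q A \<le> hausdorff_delta \<delta> q A"
      using \<delta> by (intro hausdorff_delta_antimono) simp
    also have "\<dots> \<le> ennreal (\<delta> powr (q - p)) * hausdorff_delta \<delta> p A"
      using p pq \<delta>(2) by (rule hausdorff_delta_exponent_le)
    also have "\<dots> \<le> ennreal (\<delta> powr (q - p)) * ennreal h"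
      unfolding h(1)[symmetric] using \<delta> by (intro mult_left_mono hausdorff_delta_le_outer) auto
    also have "\<dots> \<le> ennreal e"
      using \<delta> h by (simp add: ennreal_mult[symmetric] ennreal_leI)
    finally show "hausdorff_delta \<epsilon> q A \<le> 0 + ennreal e" by simp
  qed
  then show ?thesis
    unfolding hausdorff_outer_def le_zero_eq[symmetric] by (intro SUP_least) simp
qed

text \<open>The exponents of vanishing measure form exactly the open ray above \<open>t\<close>: a
  zero below \<open>t\<close> would propagate upwards to \<open>t\<close>, and finiteness at
  \<open>t\<close> forces zeros beyond it.\<close>

lemma hausdorff_dim_eqI:
  assumes "0 \<le> t" "hausdorff_outer t A < \<infinity>" "hausdorff_outer t A \<noteq> 0"
  shows "hausdorff_dim A = t"
proof -
  have "{u. 0 \<le> u \<and> hausdorff_outer u A = 0} = {t<..}"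
  proof (intro set_eqI iffI)
    fix u assume "u \<in> {u. 0 \<le> u \<and> hausdorff_outer u A = 0}"
    then show "u \<in> {t<..}"
      using assms hausdorff_outer_eq_0_exponent_mono[of u t A] by (cases u t rule: linorder_cases) auto
  qed (use assms hausdorff_outer_eq_0_exponent_mono[of t _ A] in auto)
  then show ?thesis by (simp add: hausdorff_dim_def)
qed

text \<open>Prepares arbitrary covers for compactness: covering sets become open at an arbitrarily
  small cost. The bound \<open>d\<close> replaces the diameter and is strictly positive even for
  single points, so that its powers behave uniformly, including for \<open>s = 0\<close>.\<close>

lemma diam_pow_open_enlargement:
  fixes E :: "'a::metric_space set"
  assumes "bounded E" "E \<noteq> {}" "0 \<le> s" "0 < e"
  shows "\<exists>U d. open U \<and> E \<subseteq> U \<and> 0 < d \<and> (\<forall>x\<in>U. \<forall>y\<in>U. dist x y \<le> d) \<and>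
    ennreal (d powr s) \<le> diam_pow s E + ennreal e"
proof -
  have D: "0 \<le> diameter E" using assms(1) by (rule diameter_ge_0)
  have "\<exists>\<eta>>0. ennreal ((diameter E + 2 * \<eta>) powr s) \<le> diam_pow s E + ennreal e"
  proof (cases "s = 0")
    case True
    then show ?thesis
      using assms D by (intro exI[of _ 1]) (auto simp: diam_pow_def)
  next
    case False
    have "((\<lambda>\<eta>. (diameter E + 2 * \<eta>) powr s) \<longlongrightarrow> (diameter E + 2 * 0) powr s) (at_right 0)"
      using False assms D
      by (intro tendsto_intros tendsto_powr') (auto simp: eventually_at_filter)
    then have "\<forall>\<^sub>F \<eta> in at_right 0. (diameter E + 2 * \<eta>) powr s < diameter E powr s + e"
      using assms by (intro order_tendstoD(2)) auto
    then have "\<forall>\<^sub>F \<eta> in at_right 0. (diameter E + 2 * \<eta>) powr s < diameter E powr s + e \<and> 0 < \<eta>"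
      using eventually_at_right_less[of "0::real"] by eventually_elim auto
    then obtain \<eta> where "(diameter E + 2 * \<eta>) powr s < diameter E powr s + e" "0 < \<eta>"
      by (rule eventually_happens'[rotated, THEN exE]) auto
    then show ?thesis
      using False assms
      by (intro exI[of _ \<eta>]) (auto simp: diam_pow_def ennreal_plus[symmetric] simp del: ennreal_plus
          intro!: ennreal_leI)
  qed
  then obtain \<eta> where \<eta>: "0 < \<eta>" "ennreal ((diameter E + 2 * \<eta>) powr s) \<le> diam_pow s E + ennreal e"
    by blast
  show ?thesis
  proof (intro exI conjI ballI)
    show "open (\<Union>x\<in>E. ball x \<eta>)" by auto
    show "E \<subseteq> (\<Union>x\<in>E. ball x \<eta>)" using \<eta> by auto
    show "0 < diameter E + 2 * \<eta>" using \<eta> D by simp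
    fix x y assume "x \<in> (\<Union>x\<in>E. ball x \<eta>)" "y \<in> (\<Union>x\<in>E. ball x \<eta>)"
    then obtain u v where uv: "u \<in> E" "v \<in> E" "dist u x < \<eta>" "dist v y < \<eta>" by auto
    then have "dist u v \<le> diameter E" using assms(1) by (intro diameter_bounded_bound)
    moreover have "dist x y \<le> dist u x + dist u v + dist v y"
      by (smt (verit) dist_commute dist_triangle)
    ultimately show "dist x y \<le> diameter E + 2 * \<eta>" using uv by simp
  qed (use \<eta> in auto)
qed

section \<open>Locally finite Borel measures\<close>

lemma sets_measure_restr [simp, measurable_cong]: "sets (measure_restr M A) = sets M"
  by (simp add: measure_restr_def)

lemma space_hausdorff_measure [simp]: "space (hausdorff_measure s) = UNIV"
  using sets_eq_imp_space_eq[OF sets_hausdorff_measure[of s]] by simp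

lemma integral_measure_restr:
  fixes f :: "'a \<Rightarrow> real"
  assumes "A \<in> sets M" "f \<in> borel_measurable M"
  shows "(\<integral>x. f x \<partial>measure_restr M A) = (\<integral>x. indicator A x * f x \<partial>M)"
  using integral_density[of f M "indicator A"] assms
  by (simp add: measure_restr_def ennreal_indicator)

text \<open>Allows a magnification, or a limit set, to be replaced by a similar copy of
  \<open>C\<close> that agrees with it only on a ball containing the support of
  \<open>f\<close>.\<close>

lemma integral_measure_restr_cong:
  fixes f :: "'a \<Rightarrow> real"
  assumes "A \<in> sets M" "B \<in> sets M" "f \<in> borel_measurable M"
    and "A \<inter> S = B \<inter> S" "\<And>x. x \<notin> S \<Longrightarrow> f x = 0"
  shows "(\<integral>x. f x \<partial>measure_restr M A) = (\<integral>x. f x \<partial>measure_restr M B)"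
proof -
  have "(\<lambda>x. indicator A x * f x) = (\<lambda>x. indicator B x * f x)"
    using assms(4,5) by (intro ext) (auto simp: indicator_def)
  then show ?thesis
    by (simp only: integral_measure_restr[OF assms(1,3)] integral_measure_restr[OF assms(2,3)])
qed

lemma integral_scale_measure:
  fixes f :: "'a \<Rightarrow> real"
  assumes "0 \<le> c" "f \<in> borel_measurable M"
  shows "(\<integral>x. f x \<partial>scale_measure (ennreal c) M) = c * (\<integral>x. f x \<partial>M)"
proof -
  have "scale_measure (ennreal c) M = density M (\<lambda>_. ennreal c)"
    by (rule measure_eqI) (simp_all add: emeasure_density_const)
  then show ?thesis using assms integral_density[of f M "\<lambda>_. c"] by simp
qed

text \<open>On a Borel set \<open>A\<close> both sides reduce to the outer measure of the image of
  the part of \<open>C\<close> that \<psi> sends into \<open>A\<close>, where the scaling law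
  applies. \<psi> is Borel everywhere but a similarity only on \<open>C\<close>; this suits a limit
  map extended arbitrarily outside \<open>C\<close>.\<close>

lemma measure_restr_similarity_image:
  fixes C :: "'a::euclidean_space set" and \<psi> :: "'a \<Rightarrow> 'b::euclidean_space"
  assumes C: "compact C" and \<psi>: "\<psi> \<in> borel_measurable borel" "similarity_on \<rho> C \<psi>" and s: "0 \<le> s"
  shows "measure_restr (hausdorff_measure s) (\<psi> ` C) =
    scale_measure (ennreal (\<rho> powr s)) (distr (measure_restr (hausdorff_measure s) C) borel \<psi>)"
proof (rule measure_eqI)
  fix A assume "A \<in> sets (measure_restr (hausdorff_measure s) (\<psi> ` C))"
  then have A: "A \<in> sets borel" by simp
  have pre: "\<psi> -` A \<in> sets borel"
    using measurable_sets[OF \<psi>(1) A] by simp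
  have Cb: "C \<in> sets borel" using C by (intro borel_closed compact_imp_closed)
  have "compact (\<psi> ` C)"
    using C similarity_on_continuous[OF \<psi>(2)] by (rule compact_continuous_image[rotated])
  then have im: "\<psi> ` C \<in> sets borel" by (intro borel_closed compact_imp_closed)
  have meas: "\<psi> \<in> measurable (measure_restr (hausdorff_measure s) C) borel"
    using \<psi>(1) by (simp cong: measurable_cong_sets)
  have "\<psi> ` C \<inter> A = \<psi> ` (C \<inter> \<psi> -` A)" by auto
  then have "emeasure (measure_restr (hausdorff_measure s) (\<psi> ` C)) A
      = hausdorff_outer s (\<psi> ` (C \<inter> \<psi> -` A))"
    using emeasure_measure_restr_hausdorff[OF im A, of s] by simp
  also have "\<dots> = ennreal (\<rho> powr s) * hausdorff_outer s (C \<inter> \<psi> -` A)"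
    by (rule hausdorff_outer_similarity_image[OF similarity_on_subset[OF \<psi>(2)] s]) auto
  also have "\<dots> = emeasure (scale_measure (ennreal (\<rho> powr s))
      (distr (measure_restr (hausdorff_measure s) C) borel \<psi>)) A"
    using emeasure_measure_restr_hausdorff[OF Cb pre, of s] emeasure_distr[OF meas A]
    by (simp add: measure_restr_def)
  finally show "emeasure (measure_restr (hausdorff_measure s) (\<psi> ` C)) A = \<dots>" .
qed simp

section \<open>Test functions, uniqueness and regularity\<close>

definition test_function :: "('a::euclidean_space \<Rightarrow> real) \<Rightarrow> bool" where
  "test_function f \<longleftrightarrow> continuous_on UNIV f \<and> compact (closure {y. f y \<noteq> 0})"

lemma test_function_measurable: "test_function f \<Longrightarrow> f \<in> borel_measurable borel"
  by (simp add: test_function_def borel_measurable_continuous_onI)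

lemma test_function_bounded:
  assumes "test_function f"
  shows "\<exists>B\<ge>0. \<forall>y. \<bar>f y\<bar> \<le> B"
proof -
  let ?K = "closure {y. f y \<noteq> 0}"
  have "compact (f ` ?K)"
    using assms continuous_on_subset[of UNIV f ?K]
    by (intro compact_continuous_image) (simp_all add: test_function_def)
  then obtain B where B: "\<And>v. v \<in> f ` ?K \<Longrightarrow> \<bar>v\<bar> \<le> B"
    using compact_imp_bounded[of "f ` ?K"] unfolding bounded_iff by force
  have "\<bar>f y\<bar> \<le> max B 0" for y
  proof (cases "f y = 0")
    case False
    then have "y \<in> ?K" using closure_subset[of "{y. f y \<noteq> 0}"] by auto
    then have "\<bar>f y\<bar> \<le> B" by (intro B imageI)
    then show ?thesis by simp
  qed simp
  then show ?thesis by (intro exI[of _ "max B 0"]) auto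
qed

lemma test_function_support:
  assumes "test_function f"
  shows "\<exists>R>0. \<forall>y. y \<notin> ball 0 R \<longrightarrow> f y = 0"
proof -
  have "bounded (closure {y. f y \<noteq> 0})"
    using assms by (auto simp: test_function_def intro: compact_imp_bounded)
  then obtain R where R: "0 < R" "closure {y. f y \<noteq> 0} \<subseteq> ball 0 R"
    using bounded_subset_ballD by blast
  have "f y = 0" if "y \<notin> ball 0 R" for y
    using R that closure_subset[of "{y. f y \<noteq> 0}"] by blast
  then show ?thesis using R by blast
qed

lemma test_function_integrable:
  assumes f: "test_function f" and M: "sets M = sets borel"
    and fin: "\<And>K. compact K \<Longrightarrow> emeasure M K < \<infinity>"
  shows "integrable M f"
proof -
  obtain B where B: "0 \<le> B" "\<And>y. \<bar>f y\<bar> \<le> B" using test_function_bounded[OF f] by blast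
  obtain R where R: "0 < R" "\<And>y. y \<notin> ball 0 R \<Longrightarrow> f y = 0" using test_function_support[OF f] by blast
  have "emeasure M (cball 0 R) < \<infinity>" by (intro fin) auto
  then have i: "integrable M (\<lambda>y. B * indicator (cball 0 R) y)"
    by (intro integrable_mult_right integrable_real_indicator) (auto simp: M)
  have m: "f \<in> borel_measurable M"
    using test_function_measurable[OF f] by (simp add: M cong: measurable_cong_sets)
  show ?thesis
  proof (rule Bochner_Integration.integrable_bound[OF i m AE_I2])
    fix y
    show "norm (f y) \<le> norm (B * indicator (cball 0 R) y :: real)"
      using B R(2)[of y] by (auto simp: indicator_def)
  qed
qed

lemma test_function_bump:
  assumes "compact K" "K \<noteq> {}" "0 < k"
  shows "test_function (\<lambda>y. max 0 (1 - k * infdist y K))"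
  unfolding test_function_def
proof
  show "continuous_on UNIV (\<lambda>y. max 0 (1 - k * infdist y K))"
    by (intro continuous_intros)
  let ?S = "{y. max 0 (1 - k * infdist y K) \<noteq> 0}"
  obtain R where R: "\<And>z. z \<in> K \<Longrightarrow> norm z \<le> R"
    using compact_imp_bounded[OF assms(1)] unfolding bounded_iff by blast
  have "bounded ?S"
    unfolding bounded_iff
  proof (intro exI ballI)
    fix y assume "y \<in> ?S"
    then have "k * infdist y K < 1" by auto
    then have "infdist y K < 1 / k" using assms by (simp add: field_simps)
    moreover obtain z where z: "z \<in> K" "infdist y K = dist y z"
      using infdist_attains_inf[OF compact_imp_closed[OF assms(1)] assms(2)] by blast
    ultimately have "dist y z < 1 / k" by simp
    moreover have "norm y \<le> norm z + dist y z"
      by (metis dist_norm norm_triangle_sub)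
    ultimately show "norm y \<le> R + 1 / k" using R[OF z(1)] by simp
  qed
  then show "compact (closure ?S)" by (simp add: compact_closure)
qed

text \<open>The bumps around a compact set decrease to its indicator, so dominated convergence, with
  the first bump as majorant, yields equality on compact sets. These are stable under intersection,
  generate the Borel sets and exhaust the space by balls of finite measure.\<close>

lemma measure_eqI_test_functions:
  fixes M N :: "'a::euclidean_space measure"
  assumes M: "sets M = sets borel" "\<And>K. compact K \<Longrightarrow> emeasure M K < \<infinity>"
    and N: "sets N = sets borel" "\<And>K. compact K \<Longrightarrow> emeasure N K < \<infinity>"
    and eq: "\<And>f. test_function f \<Longrightarrow> (\<integral>y. f y \<partial>M) = (\<integral>y. f y \<partial>N)"
  shows "M = N"
proof -
  have conv: "(\<lambda>n. \<integral>y. max 0 (1 - real (Suc n) * infdist y K) \<partial>L) \<longlonglongrightarrow> measure L K"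
    if K: "compact K" "K \<noteq> {}" and L: "sets L = sets borel" "\<And>K. compact K \<Longrightarrow> emeasure L K < \<infinity>"
    for K and L :: "'a measure"
  proof -
    let ?f = "\<lambda>n y. max 0 (1 - real (Suc n) * infdist y K)"
    have "(\<lambda>n. \<integral>y. ?f n y \<partial>L) \<longlonglongrightarrow> (\<integral>y. indicator K y \<partial>L)"
    proof (rule integral_dominated_convergence[where w = "?f 0"])
      have Kb: "K \<in> sets L" using K L by (simp add: compact_imp_closed)
      then show "(indicator K :: 'a \<Rightarrow> real) \<in> borel_measurable L" by simp
      show "integrable L (?f 0)"
        by (rule test_function_integrable[OF test_function_bump L]) (use K in auto)
      show "?f n \<in> borel_measurable L" for n
        using test_function_measurable[OF test_function_bump[OF K, of "real (Suc n)"]] L(1)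
        by (simp cong: measurable_cong_sets)
      show "AE y in L. (\<lambda>n. ?f n y) \<longlonglongrightarrow> indicator K y"
      proof (rule AE_I2)
        fix y
        show "(\<lambda>n. ?f n y) \<longlonglongrightarrow> indicator K y"
        proof (cases "y \<in> K")
          case False
          then have pos: "0 < infdist y K"
            using K in_closed_iff_infdist_zero[of K y] infdist_nonneg[of y K] compact_imp_closed
            by force
          obtain n0 :: nat where n0: "1 / infdist y K < real n0"
            using reals_Archimedean2 by blast
          have "?f n y = 0" if "n0 \<le> n" for n
          proof -
            have "1 / infdist y K < real (Suc n)" using n0 that by linarith
            then show ?thesis using pos by (simp add: field_simps)
          qed
          then show ?thesis
            using False by (intro tendsto_eventually) (auto simp: eventually_sequentially)
        qed simp
      qed
      show "AE y in L. norm (?f n y) \<le> ?f 0 y" for n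
      proof (rule AE_I2)
        fix y
        have "1 * infdist y K \<le> real (Suc n) * infdist y K"
          by (intro mult_right_mono) (auto simp: infdist_nonneg)
        then show "norm (?f n y) \<le> ?f 0 y" by auto
      qed
    qed
    moreover have "space L = UNIV" using sets_eq_imp_space_eq[OF L(1)] by simp
    ultimately show ?thesis by simp
  qed
  have K: "emeasure M K = emeasure N K" if "compact K" for K
  proof (cases "K = {}")
    case False
    have "(\<integral>y. max 0 (1 - real (Suc n) * infdist y K) \<partial>M)
        = (\<integral>y. max 0 (1 - real (Suc n) * infdist y K) \<partial>N)" for n
      by (rule eq[OF test_function_bump]) (use that False in auto)
    then have "measure M K = measure N K"
      using conv[OF that False M] conv[OF that False N] LIMSEQ_unique by auto
    then show ?thesis
      using M(2)[OF that] N(2)[OF that]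
      by (metis emeasure_eq_ennreal_measure infinity_ennreal_def less_irrefl)
  qed simp
  have sig: "sets borel = sigma_sets UNIV (Collect (compact :: 'a set \<Rightarrow> bool))"
  proof
    show "sigma_sets UNIV (Collect compact) \<subseteq> sets (borel :: 'a measure)"
      using sets.sigma_sets_subset[of "Collect compact" "borel :: 'a measure"]
      by (auto intro: borel_closed compact_imp_closed)
    have "A \<in> sigma_sets UNIV (Collect compact)" if "closed A" for A :: "'a set"
    proof -
      have "A = (\<Union>n. A \<inter> cball 0 (real n))"
        by (auto simp: real_arch_simple)
      moreover have "(\<Union>n. A \<inter> cball 0 (real n)) \<in> sigma_sets UNIV (Collect compact)"
        using that by (intro sigma_sets.Union sigma_sets.Basic) (auto intro: closed_Int_compact)
      ultimately show ?thesis by simp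
    qed
    then have "sigma_sets UNIV (Collect closed) \<subseteq> sigma_sets UNIV (Collect (compact :: 'a set \<Rightarrow> bool))"
      by (intro sigma_sets_mono) auto
    then show "sets (borel :: 'a measure) \<subseteq> sigma_sets UNIV (Collect compact)"
      by (simp add: borel_eq_closed)
  qed
  show ?thesis
  proof (rule measure_eqI_generator_eq[where E = "Collect compact" and \<Omega> = UNIV
        and A = "\<lambda>n. cball 0 (real n)"])
    show "Int_stable (Collect (compact :: 'a set \<Rightarrow> bool))"
      by (auto simp: Int_stable_def intro: compact_Int)
    show "(\<Union>n. cball (0::'a) (real n)) = UNIV"
      by (auto simp: real_arch_simple)
    show "emeasure M (cball 0 (real n)) \<noteq> \<infinity>" for n
      using M(2)[of "cball 0 (real n)"] by auto
  qed (use K M N sig in auto)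
qed

text \<open>In a Euclidean space local finiteness implies both regularity conditions. Open sets are
  increasing unions of compact sets; for Borel sets, outer approximations inside balls are joined
  with errors that sum to \<open>e\<close>.\<close>

lemma radon_measureI:
  fixes M :: "'a::euclidean_space measure"
  assumes M: "sets M = sets borel" and fin: "\<And>K. compact K \<Longrightarrow> emeasure M K < \<infinity>"
  shows "radon_measure M"
  unfolding radon_measure_def
proof (intro conjI allI impI ballI)
  show "sets M = sets borel" by (rule M)
  show "emeasure M K < \<infinity>" if "compact K" for K using that by (rule fin)
  fix U :: "'a set" assume U: "open U"
  show "emeasure M U = (SUP K\<in>{K. compact K \<and> K \<subseteq> U}. emeasure M K)"
  proof (rule antisym)
    obtain D :: "nat \<Rightarrow> 'a set" where D: "\<And>n. compact (D n)" "\<And>n. D n \<subseteq> U"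
        "\<And>n. D n \<subseteq> D (Suc n)" "(\<Union>n. D n) = U"
      using open_Union_compact_subsets[OF U] by (metis interior_subset order_trans)
    have "emeasure M U = (SUP n. emeasure M (D n))"
      unfolding D(4)[symmetric]
    proof (rule SUP_emeasure_incseq[symmetric])
      show "incseq D" using D(3) by (rule incseq_SucI)
      show "range D \<subseteq> sets M" unfolding M using D(1) by (auto simp: compact_imp_closed)
    qed
    also have "\<dots> \<le> (SUP K\<in>{K. compact K \<and> K \<subseteq> U}. emeasure M K)"
      using D by (intro SUP_least SUP_upper) auto
    finally show "emeasure M U \<le> (SUP K\<in>{K. compact K \<and> K \<subseteq> U}. emeasure M K)" .
    show "(SUP K\<in>{K. compact K \<and> K \<subseteq> U}. emeasure M K) \<le> emeasure M U"
      using U M by (intro SUP_least emeasure_mono) auto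
  qed
next
  fix A :: "'a set" assume A: "A \<in> sets borel"
  show "emeasure M A = (INF U\<in>{U. open U \<and> A \<subseteq> U}. emeasure M U)"
  proof (rule antisym)
    show "emeasure M A \<le> (INF U\<in>{U. open U \<and> A \<subseteq> U}. emeasure M U)"
      using M by (intro INF_greatest emeasure_mono) auto
    show "(INF U\<in>{U. open U \<and> A \<subseteq> U}. emeasure M U) \<le> emeasure M A"
    proof (cases "emeasure M A = \<infinity>")
      case False
      let ?B = "\<lambda>n::nat. ball (0::'a) (real n)"
      \<comment> \<open>Regularity is available for finite measures only, so it is applied to each restriction to a ball.\<close>
      have "\<exists>V. open V \<and> A \<inter> ?B n \<subseteq> V \<and> V \<subseteq> ?B n \<and> emeasure M (V - A) \<le> ennreal (e * (1/2)^Suc n)"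
        if e: "0 < e" for n e
      proof -
        let ?N = "density M (indicator (?B n))"
        have Nem: "emeasure ?N X = emeasure M (?B n \<inter> X)" if "X \<in> sets borel" for X
          using that M by (intro emeasure_restricted) auto
        have finB: "emeasure M (?B n) < \<infinity>"
          using fin[of "cball 0 (real n)"] emeasure_mono[of "?B n" "cball 0 (real n)" M] M
          by (auto intro: le_less_trans)
        have sp: "space ?N = UNIV" using sets_eq_imp_space_eq[OF M] by simp
        have "emeasure ?N A = (INF U\<in>{U. A \<subseteq> U \<and> open U}. emeasure ?N U)"
          by (rule outer_regular) (use M A finB Nem[of UNIV] sp in auto)
        moreover have NA: "emeasure ?N A < \<infinity>"
          using Nem[OF A] finB emeasure_mono[of "?B n \<inter> A" "?B n" M] M
          by (auto intro: le_less_trans)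
        moreover have "emeasure ?N A < emeasure ?N A + ennreal (e * (1/2)^Suc n)"
          using ennreal_add_left_cancel_less[of "emeasure ?N A" 0 "ennreal (e * (1/2)^Suc n)"] NA e by auto
        ultimately obtain U where U: "A \<subseteq> U" "open U"
            "emeasure ?N U < emeasure ?N A + ennreal (e * (1/2)^Suc n)"
          by (auto simp: INF_less_iff)
        have eq: "emeasure M ((U \<inter> ?B n) - A) = emeasure ?N U - emeasure ?N A"
        proof -
          have "?B n \<inter> U - ?B n \<inter> A = U \<inter> ?B n - A" by auto
          moreover have "emeasure M (?B n \<inter> U - ?B n \<inter> A) = emeasure M (?B n \<inter> U) - emeasure M (?B n \<inter> A)"
            using NA Nem[OF A] U A M by (intro emeasure_Diff) auto
          ultimately show ?thesis using Nem[OF A] Nem[of U] U by simp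
        qed
        have "emeasure ?N U - emeasure ?N A \<le> ennreal (e * (1/2)^Suc n)"
          using U(3) NA by (intro ennreal_minus_le_iff[THEN iffD2]) (auto simp: add.commute)
        then have "emeasure M ((U \<inter> ?B n) - A) \<le> ennreal (e * (1/2)^Suc n)"
          by (simp add: eq)
        then show ?thesis using U by (intro exI[of _ "U \<inter> ?B n"]) auto
      qed
      then have ex: "\<forall>e>0. \<exists>V. \<forall>n. open (V n) \<and> A \<inter> ?B n \<subseteq> V n \<and> V n \<subseteq> ?B n \<and>
          emeasure M (V n - A) \<le> ennreal (e * (1/2)^Suc n)"
        by metis
      show ?thesis
      proof (rule ennreal_le_epsilon)
        fix e :: real assume e: "0 < e"
        obtain V where "\<forall>n. open (V n) \<and> A \<inter> ?B n \<subseteq> V n \<and> V n \<subseteq> ?B n \<and>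
            emeasure M (V n - A) \<le> ennreal (e * (1/2)^Suc n)"
          using ex[rule_format, OF e] ..
        then have V: "\<And>n. open (V n)" "\<And>n. A \<inter> ?B n \<subseteq> V n"
            "\<And>n. emeasure M (V n - A) \<le> ennreal (e * (1/2)^Suc n)"
          by simp_all
        let ?V = "\<Union>n. V n"
        have "A \<subseteq> ?V"
        proof
          fix y assume "y \<in> A"
          moreover obtain n :: nat where "norm y < real n" using reals_Archimedean2 by blast
          ultimately show "y \<in> ?V" using V(2)[of n] by auto
        qed
        have diff: "emeasure M (?V - A) \<le> ennreal e"
        proof -
          have "?V - A = (\<Union>n. V n - A)" by auto
          also have "emeasure M \<dots> \<le> (\<Sum>n. emeasure M (V n - A))"
            using V A M by (intro emeasure_subadditive_countably) auto
          also have "\<dots> \<le> (\<Sum>n. ennreal (e * (1/2)^Suc n))"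
            using V(3) by (intro suminf_le) auto
          also have "\<dots> = ennreal e"
            using sums_mult[OF power_half_series, of e] e
            by (intro suminf_ennreal_eq) (auto simp: power_divide)
          finally show ?thesis .
        qed
        have "(INF U\<in>{U. open U \<and> A \<subseteq> U}. emeasure M U) \<le> emeasure M ?V"
          using V \<open>A \<subseteq> ?V\<close> by (intro INF_lower) auto
        also have "?V = A \<union> (?V - A)" using \<open>A \<subseteq> ?V\<close> by auto
        also have "emeasure M \<dots> \<le> emeasure M A + emeasure M (?V - A)"
          using V A M by (intro emeasure_subadditive) auto
        also have "\<dots> \<le> emeasure M A + ennreal e"
          using diff by (rule add_left_mono)
        finally show "(INF U\<in>{U. open U \<and> A \<subseteq> U}. emeasure M U) \<le> emeasure M A + ennreal e" .
      qed
    qed simp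
  qed
qed

section \<open>The hit-and-miss topology\<close>

text \<open>Eventual membership passes to finite intersections and to unions, so the generating sets
  suffice. The sets \<open>H k\<close> must be closed because the generating sets contain closed
  sets only.\<close>

lemma limitin_hit_miss_iff:
  fixes H :: "nat \<Rightarrow> 'a::euclidean_space set"
  assumes H: "\<And>k. closed (H k)"
  shows "limitin hit_miss_topology H F sequentially \<longleftrightarrow> closed F \<and>
    (\<forall>K. compact K \<and> F \<inter> K = {} \<longrightarrow> (\<forall>\<^sub>F k in sequentially. H k \<inter> K = {})) \<and>
    (\<forall>G. open G \<and> F \<inter> G \<noteq> {} \<longrightarrow> (\<forall>\<^sub>F k in sequentially. H k \<inter> G \<noteq> {}))"
    (is "?lim \<longleftrightarrow> ?cl \<and> ?miss \<and> ?hit")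
proof
  let ?S = "{{F :: 'a set. closed F \<and> F \<inter> K = {}} |K. compact K} \<union>
    {{F. closed F \<and> F \<inter> G \<noteq> {}} |G. open G}"
  have sub: "openin hit_miss_topology U" if "U \<in> ?S" for U
    unfolding hit_miss_topology_def using that by (rule topology_generated_by_Basis)
  {
    assume l: ?lim
    then have cl: ?cl by (auto simp: limitin_def topspace_hit_miss_topology)
    have ?miss
    proof (intro allI impI)
      fix K :: "'a set" assume "compact K \<and> F \<inter> K = {}"
      then have "\<forall>\<^sub>F k in sequentially. H k \<in> {F. closed F \<and> F \<inter> K = {}}"
        using cl by (intro limitinD[OF l] sub) auto
      then show "\<forall>\<^sub>F k in sequentially. H k \<inter> K = {}" by (rule eventually_mono) auto
    qed
    moreover have ?hit
    proof (intro allI impI)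
      fix G :: "'a set" assume "open G \<and> F \<inter> G \<noteq> {}"
      then have "\<forall>\<^sub>F k in sequentially. H k \<in> {F. closed F \<and> F \<inter> G \<noteq> {}}"
        using cl by (intro limitinD[OF l] sub) auto
      then show "\<forall>\<^sub>F k in sequentially. H k \<inter> G \<noteq> {}" by (rule eventually_mono) auto
    qed
    ultimately show "?cl \<and> ?miss \<and> ?hit" using cl by blast
  }
  assume r: "?cl \<and> ?miss \<and> ?hit"
  have "F \<in> U \<longrightarrow> (\<forall>\<^sub>F k in sequentially. H k \<in> U)" if "generate_topology_on ?S U" for U
    using that
  proof induction
    case (Int a b)
    then show ?case by (auto intro: eventually_conj)
  next
    case (UN K)
    show ?case
    proof
      assume "F \<in> \<Union>K"
      then obtain U where "U \<in> K" "F \<in> U" by blast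
      with UN have "\<forall>\<^sub>F k in sequentially. H k \<in> U" by blast
      then show "\<forall>\<^sub>F k in sequentially. H k \<in> \<Union>K"
        by (rule eventually_mono) (use \<open>U \<in> K\<close> in blast)
    qed
  next
    case (Basis U)
    then show ?case using r H by auto
  qed simp
  then show ?lim
    using r unfolding limitin_def topspace_hit_miss_topology
    by (auto simp: hit_miss_topology_def openin_topology_generated_by_iff)
qed

text \<open>A diagonal argument over a countable basis makes every basic set either eventually hit
  or eventually missed. Hitting then follows from the choice of the limit; a compact set disjoint
  from the limit is covered by finitely many basic sets that are eventually missed.\<close>

lemma hit_miss_convergent_subsequence:
  fixes H :: "nat \<Rightarrow> 'a::euclidean_space set"
  assumes H: "\<And>k. closed (H k)"
  shows "\<exists>F \<sigma>. strict_mono \<sigma> \<and> limitin hit_miss_topology (H \<circ> \<sigma>) F sequentially"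
proof -
  obtain \<B> :: "'a set set" where \<B>: "countable \<B>" "topological_basis \<B>"
    using ex_countable_basis by blast
  have "\<B> \<noteq> {}"
    using topological_basisE[OF \<B>(2) open_UNIV, of 0] by blast
  then have B: "topological_basis (range (from_nat_into \<B>))"
    using \<B> by (simp add: range_from_nat_into)
  define B where "B = from_nat_into \<B>"
  note B = B[folded B_def]
  define P where "P n \<tau> \<longleftrightarrow> (\<forall>\<^sub>F k in sequentially. H (\<tau> k) \<inter> B n \<noteq> {}) \<or>
    (\<forall>\<^sub>F k in sequentially. H (\<tau> k) \<inter> B n = {})" for n and \<tau> :: "nat \<Rightarrow> nat"
  have P_subseq: "P n (\<tau> \<circ> r')" if P: "P n \<tau>" and r': "strict_mono r'" for n \<tau> r'
  proof -
    have "\<forall>\<^sub>F k in sequentially. Q (\<tau> (r' k))" if "\<forall>\<^sub>F k in sequentially. Q (\<tau> k)" for Q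
      using eventually_subseq[OF r' that] .
    from this[of "\<lambda>j. H j \<inter> B n \<noteq> {}"] this[of "\<lambda>j. H j \<inter> B n = {}"]
    show ?thesis using P unfolding P_def comp_def by blast
  qed
  interpret subseqs P
  proof
    fix n and \<tau> :: "nat \<Rightarrow> nat"
    show "\<exists>r'. strict_mono r' \<and> P n (\<tau> \<circ> r')"
    proof (cases "infinite {k. H (\<tau> k) \<inter> B n \<noteq> {}}")
      case True
      obtain r' :: "nat \<Rightarrow> nat" where
        r': "strict_mono r'" "\<forall>k. r' k \<in> {k. H (\<tau> k) \<inter> B n \<noteq> {}}"
        using infinite_enumerate[OF True] by blast
      then have "P n (\<tau> \<circ> r')" by (auto simp: P_def)
      with r' show ?thesis by blast
    next
      case False
      then have "\<forall>\<^sub>F k in sequentially. H (\<tau> k) \<inter> B n = {}"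
        by (simp add: eventually_cofinite flip: cofinite_eq_sequentially)
      then show ?thesis by (intro exI[of _ id]) (auto simp: P_def strict_mono_def)
    qed
  qed
  define d where "d = diagseq"
  have diag: "P n d" for n
  proof -
    \<comment> \<open>The diagonal sequence is a subsequence of the n-th extracted one only from
      index \<open>Suc n\<close> on, which suffices because \<open>P n\<close> concerns
      tails.\<close>
    have "P n (d \<circ> ((+) (Suc n)))"
      unfolding d_def by (rule diagseq_holds) (rule P_subseq)
    then show ?thesis
      unfolding P_def comp_def
      using eventually_sequentially_seg[of "\<lambda>k. H (d k) \<inter> B n \<noteq> {}" "Suc n"]
        eventually_sequentially_seg[of "\<lambda>k. H (d k) \<inter> B n = {}" "Suc n"]
      by (simp add: add.commute)
  qed
  \<comment> \<open>A point belongs to the limit when all its basic neighbourhoods are eventually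
    hit; any other point has a basic neighbourhood that is eventually missed.\<close>
  define F where "F = {y. \<forall>n. y \<in> B n \<longrightarrow> (\<forall>\<^sub>F k in sequentially. H (d k) \<inter> B n \<noteq> {})}"
  have openB: "open (B n)" for n using B by (auto intro: topological_basis_open)
  have basis: "\<exists>n. y \<in> B n \<and> B n \<subseteq> G" if "open G" "y \<in> G" for y G
    using topological_basisE[OF B that] by blast
  have notF: "\<exists>n. y \<in> B n \<and> (\<forall>\<^sub>F k in sequentially. H (d k) \<inter> B n = {})" if "y \<notin> F" for y
    using that diag unfolding F_def P_def by blast
  have "limitin hit_miss_topology (H \<circ> d) F sequentially"
  proof (subst limitin_hit_miss_iff)
    show "closed ((H \<circ> d) k)" for k using H by simp
    have "closed F"
    proof -
      have "- F = (\<Union>n\<in>{n. \<not> (\<forall>\<^sub>F k in sequentially. H (d k) \<inter> B n \<noteq> {})}. B n)"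
        unfolding F_def by blast
      then show ?thesis using openB by (simp add: closed_def open_UN)
    qed
    moreover have "\<forall>\<^sub>F k in sequentially. H (d k) \<inter> K = {}" if K: "compact K" "F \<inter> K = {}" for K
    proof -
      define N where "N = {n. \<forall>\<^sub>F k in sequentially. H (d k) \<inter> B n = {}}"
      have "K \<subseteq> (\<Union>n\<in>N. B n)"
        using K notF unfolding N_def by blast
      then obtain D where D: "D \<subseteq> N" "finite D" "K \<subseteq> (\<Union>n\<in>D. B n)"
        using compactE_image[OF K(1), of N B] openB by blast
      have "\<forall>\<^sub>F k in sequentially. \<forall>n\<in>D. H (d k) \<inter> B n = {}"
        using D by (intro eventually_ball_finite) (auto simp: N_def)
      then show ?thesis by (rule eventually_mono) (use D in blast)
    qed
    moreover have "\<forall>\<^sub>F k in sequentially. H (d k) \<inter> G \<noteq> {}" if G: "open G" "F \<inter> G \<noteq> {}" for G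
    proof -
      obtain y where y: "y \<in> F" "y \<in> G" using G by blast
      obtain n where n: "y \<in> B n" "B n \<subseteq> G" using basis[OF G(1) y(2)] by blast
      then have "\<forall>\<^sub>F k in sequentially. H (d k) \<inter> B n \<noteq> {}"
        using y by (simp add: F_def)
      then show ?thesis by (rule eventually_mono) (use n in blast)
    qed
    ultimately show "closed F \<and>
      (\<forall>K. compact K \<and> F \<inter> K = {} \<longrightarrow> (\<forall>\<^sub>F k in sequentially. (H \<circ> d) k \<inter> K = {})) \<and>
      (\<forall>G. open G \<and> F \<inter> G \<noteq> {} \<longrightarrow> (\<forall>\<^sub>F k in sequentially. (H \<circ> d) k \<inter> G \<noteq> {}))"
      by simp
  qed
  then show ?thesis using subseq_diagseq d_def by blast
qed

text \<open>Hitting small open sets puts points of \<open>F\<close> into the closure of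
  \<open>g\<close> C\<open>; missing small closed balls puts points of\<close>g \<open>C\<close>
  into \<open>F\<close>. The ball is open, which leaves room around each of its points for these
  small sets, where \<open>H k\<close> and the copy agree.\<close>

lemma limitin_hit_miss_local:
  fixes H :: "nat \<Rightarrow> 'a::euclidean_space set" and g :: "'b::metric_space \<Rightarrow> 'a"
  assumes lim: "limitin hit_miss_topology H F sequentially" and H: "\<And>k. closed (H k)"
    and loc: "\<And>k. H k \<inter> ball 0 R = \<psi> k ` C \<inter> ball 0 R"
    and unif: "uniform_limit C \<psi> g sequentially" and C: "compact (g ` C)"
  shows "F \<inter> ball 0 R = g ` C \<inter> ball 0 R"
proof -
  note L = lim[unfolded limitin_hit_miss_iff[of H, OF H]]
  show ?thesis
  proof (intro equalityI subsetI)
    fix y assume y: "y \<in> F \<inter> ball 0 R"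
    have "\<exists>z\<in>g ` C. dist z y < e" if e: "0 < e" for e
    proof -
      let ?G = "ball 0 R \<inter> ball y (e / 2)"
      have "\<forall>\<^sub>F k in sequentially. H k \<inter> ?G \<noteq> {}"
      proof -
        have "open ?G" by auto
        moreover have "y \<in> F \<inter> ?G" using y e by auto
        ultimately show ?thesis using L by blast
      qed
      moreover have "\<forall>\<^sub>F k in sequentially. \<forall>x\<in>C. dist (\<psi> k x) (g x) < e / 2"
        using unif e by (intro uniform_limitD) auto
      ultimately have "\<forall>\<^sub>F k in sequentially. \<exists>z\<in>g ` C. dist z y < e"
      proof eventually_elim
        case (elim k)
        then obtain u where u: "u \<in> H k" "u \<in> ball 0 R" "dist y u < e / 2" by auto
        then obtain x where x: "x \<in> C" "u = \<psi> k x" using loc[of k] by blast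
        then have "dist u (g x) < e / 2" using elim by blast
        then have "dist (g x) y < e"
          using u dist_triangle_half_r[of u "g x" e y] by (simp add: dist_commute)
        then show ?case using x by blast
      qed
      then show ?thesis by simp
    qed
    then have "y \<in> closure (g ` C)" by (simp add: closure_approachable)
    then show "y \<in> g ` C \<inter> ball 0 R"
      using C y by (simp add: compact_imp_closed)
  next
    fix y assume y: "y \<in> g ` C \<inter> ball 0 R"
    then obtain x where x: "x \<in> C" "y = g x" by blast
    have "y \<in> F"
    proof (rule ccontr)
      assume "y \<notin> F"
      then have "open (ball 0 R - F)" "y \<in> ball 0 R - F" using L y by (auto intro: open_Diff)
      then obtain e where e: "0 < e" "cball y e \<subseteq> ball 0 R - F"
        using open_contains_cball by metis
      then have "F \<inter> cball y e = {}" by blast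
      then have "\<forall>\<^sub>F k in sequentially. H k \<inter> cball y e = {}" using L by auto
      moreover have "\<forall>\<^sub>F k in sequentially. \<forall>x\<in>C. dist (\<psi> k x) (g x) < e"
        using unif e by (intro uniform_limitD) auto
      ultimately have "\<forall>\<^sub>F k in sequentially. False"
      proof eventually_elim
        case (elim k)
        then have "\<psi> k x \<in> cball y e" using x by (force simp: dist_commute)
        moreover from this have "\<psi> k x \<in> H k" using e(2) x(1) loc[of k] by blast
        ultimately show ?case using elim by blast
      qed
      then show False by simp
    qed
    then show "y \<in> F \<inter> ball 0 R" using y by blast
  qed
qed

section \<open>Self-similar sets with separated pieces\<close>

text \<open>Here \<open>q\<close> are the contraction ratios, \<open>lo\<close> and
  \<open>hi\<close> bound them uniformly, \<delta> is a gap between distinct pieces, and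
  \<open>s\<close> is the solution of Moran's equation. That \<open>s\<close> is also the dimension
  is proved inside the locale, in \<open>hausdorff_dim_eq\<close>.\<close>

locale separated_ifs =
  fixes J :: "nat set" and \<phi> :: "nat \<Rightarrow> 'a::euclidean_space \<Rightarrow> 'a" and q :: "nat \<Rightarrow> real"
    and C :: "'a set" and \<delta> lo hi s :: real
  assumes finite_J: "finite J"
    and sim: "i \<in> J \<Longrightarrow> similarity_on (q i) UNIV (\<phi> i)"
    and lo: "0 < lo" "i \<in> J \<Longrightarrow> lo \<le> q i"
    and hi: "hi < 1" "i \<in> J \<Longrightarrow> q i \<le> hi"
    and compact_C: "compact C" and C_ne: "C \<noteq> {}" and C_eq: "C = (\<Union>i\<in>J. \<phi> i ` C)"
    and \<delta>_pos: "0 < \<delta>"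
    and sep: "i \<in> J \<Longrightarrow> j \<in> J \<Longrightarrow> i \<noteq> j \<Longrightarrow> x \<in> C \<Longrightarrow> y \<in> C \<Longrightarrow> \<delta> \<le> dist (\<phi> i x) (\<phi> j y)"
    and s_nonneg: "0 \<le> s" and moran: "(\<Sum>i\<in>J. q i powr s) = 1"
begin

lemma J_ne: "J \<noteq> {}"
  using C_eq C_ne by blast

lemma q_pos: "i \<in> J \<Longrightarrow> 0 < q i"
  using lo by (meson less_le_trans)

lemma hi_pos: "0 < hi"
  using J_ne q_pos hi by (metis all_not_in_conv less_le_trans)

lemma q_less_1: "i \<in> J \<Longrightarrow> q i < 1"
  using hi by (meson le_less_trans)

lemma dist_\<phi>: "i \<in> J \<Longrightarrow> dist (\<phi> i x) (\<phi> i y) = q i * dist x y"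
  using sim by (auto simp: similarity_on_def)

lemma \<phi>_in_C: "i \<in> J \<Longrightarrow> x \<in> C \<Longrightarrow> \<phi> i x \<in> C"
  using C_eq by blast

lemma closed_C: "closed C"
  using compact_C by (rule compact_imp_closed)

lemma borel_C: "C \<in> sets borel"
  using closed_C by (rule borel_closed)

section \<open>Finiteness and positivity of H^s(C)\<close>

text \<open>Each pass through the decomposition of \<open>C\<close> shrinks the mesh by
  \<open>hi\<close>, while Moran's equation keeps the total cost unchanged.\<close>

lemma hausdorff_delta_power_le:
  "hausdorff_delta (hi ^ n * (diameter C + 1)) s C \<le> diam_pow s C"
proof (induction n)
  case 0
  have "hausdorff_delta (diameter C + 1) s C \<le> (\<Sum>i::nat. diam_pow s (if i = 0 then C else {}))"
    using compact_imp_bounded[OF compact_C] diameter_ge_0[OF compact_imp_bounded[OF compact_C]]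
    by (intro hausdorff_delta_le) auto
  also have "\<dots> = (\<Sum>i\<in>{0::nat}. diam_pow s (if i = 0 then C else {}))"
    by (rule suminf_finite) auto
  finally show ?case by simp
next
  case (Suc n)
  let ?D = "diameter C + 1" and ?A = "\<lambda>i. if i \<in> J then \<phi> i ` C else {}"
  \<comment> \<open>The added 1 keeps the mesh positive even if \<open>C\<close> is a single point;
    \<open>hausdorff_delta_empty\<close> needs this for the indices outside
    \<open>J\<close>.\<close>
  have D: "0 < ?D" using diameter_ge_0[OF compact_imp_bounded[OF compact_C]] by simp
  have "C = (\<Union>i. ?A i)" by (subst C_eq) auto
  then have "hausdorff_delta (hi ^ Suc n * ?D) s C \<le> (\<Sum>i. hausdorff_delta (hi ^ Suc n * ?D) s (?A i))"
    using hausdorff_delta_UN[of "hi ^ Suc n * ?D" s ?A] by simp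
  also have "\<dots> = (\<Sum>i\<in>J. hausdorff_delta (hi ^ Suc n * ?D) s (?A i))"
    using finite_J hi_pos D by (intro suminf_finite) (auto intro!: hausdorff_delta_empty)
  also have "\<dots> \<le> (\<Sum>i\<in>J. ennreal (q i powr s) * diam_pow s C)"
  proof (rule sum_mono)
    fix i assume i: "i \<in> J"
    have "q i * (hi ^ n * ?D) \<le> hi ^ Suc n * ?D"
      using hi(2)[OF i] hi_pos D by (simp add: mult.assoc mult_right_mono)
    then have "hausdorff_delta (hi ^ Suc n * ?D) s (\<phi> i ` C)
        \<le> hausdorff_delta (q i * (hi ^ n * ?D)) s (\<phi> i ` C)"
      by (rule hausdorff_delta_antimono)
    also have "\<dots> \<le> ennreal (q i powr s) * hausdorff_delta (hi ^ n * ?D) s C"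
      by (rule hausdorff_delta_image_le[OF _ q_pos[OF i] s_nonneg]) (simp add: dist_\<phi>[OF i])
    also have "\<dots> \<le> ennreal (q i powr s) * diam_pow s C"
      by (intro mult_left_mono Suc) simp
    finally show "hausdorff_delta (hi ^ Suc n * ?D) s (?A i) \<le> ennreal (q i powr s) * diam_pow s C"
      using i by simp
  qed
  also have "\<dots> = ennreal (\<Sum>i\<in>J. q i powr s) * diam_pow s C"
    by (simp add: sum_distrib_right[symmetric] sum_ennreal)
  finally show ?case by (simp add: moran)
qed

lemma hausdorff_outer_finite: "hausdorff_outer s C < \<infinity>"
proof -
  have "hausdorff_outer s C \<le> diam_pow s C"
    unfolding hausdorff_outer_def
  proof (rule SUP_least)
    fix \<epsilon> :: real assume "\<epsilon> \<in> {0<..}"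
    have "(\<lambda>n. hi ^ n * (diameter C + 1)) \<longlonglongrightarrow> 0 * (diameter C + 1)"
      using hi_pos hi by (intro tendsto_intros LIMSEQ_power_zero) auto
    then have "\<forall>\<^sub>F n in sequentially. hi ^ n * (diameter C + 1) < \<epsilon>"
      using \<open>\<epsilon> \<in> {0<..}\<close> by (intro order_tendstoD(2)) auto
    then obtain n where "hi ^ n * (diameter C + 1) < \<epsilon>"
      by (auto simp: eventually_sequentially)
    then have "hausdorff_delta \<epsilon> s C \<le> hausdorff_delta (hi ^ n * (diameter C + 1)) s C"
      by (intro hausdorff_delta_antimono) simp
    also have "\<dots> \<le> diam_pow s C" by (rule hausdorff_delta_power_le)
    finally show "hausdorff_delta \<epsilon> s C \<le> diam_pow s C" .
  qed
  also have "\<dots> < \<infinity>" by (simp add: diam_pow_def)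
  finally show ?thesis .
qed

text \<open>A set of diameter less than \<open>\<delta>\<close> meets at most one of the pieces \<open>\<phi> i ` C\<close>. Hence a cover by
  such sets splits into covers of the pieces, and these pull back to covers of \<open>C\<close> by larger sets.\<close>

lemma finite_cover_sum_ge:
  assumes "finite I" "C \<subseteq> (\<Union>k\<in>I. U k)"
    and "\<And>k x y. k \<in> I \<Longrightarrow> x \<in> U k \<Longrightarrow> y \<in> U k \<Longrightarrow> dist x y \<le> d k"
    and "\<And>k. k \<in> I \<Longrightarrow> \<delta> * hi ^ n \<le> d k"
  shows "\<delta> powr s \<le> (\<Sum>k\<in>I. d k powr s)"
  using assms
\<comment> \<open>Pulling back along \<open>\<phi> j\<close> divides each \<open>d k\<close> by
  \<open>q j\<close>, which is at most \<open>hi\<close>, so the lower bound rises from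
  \<open>\<delta> * hi ^ Suc n\<close> to \<open>\<delta> * hi ^ n\<close>. At \<open>n = 0\<close>
  a single set already costs enough; Moran's equation adds up the estimates of the pieces.\<close>
proof (induction n arbitrary: I U d)
  case 0
  obtain k where k: "k \<in> I" using "0.prems"(2) C_ne by blast
  have "\<delta> powr s \<le> d k powr s"
    using "0.prems"(4)[OF k] \<delta>_pos s_nonneg by (intro powr_mono2) auto
  also have "\<dots> \<le> (\<Sum>k\<in>I. d k powr s)"
    using "0.prems"(1) k by (intro member_le_sum) auto
  finally show ?case .
next
  case (Suc n)
  show ?case
  proof (cases "\<exists>k\<in>I. \<delta> \<le> d k")
    case True
    then obtain k where k: "k \<in> I" "\<delta> \<le> d k" by blast
    have "\<delta> powr s \<le> d k powr s"
      using k \<delta>_pos s_nonneg by (intro powr_mono2) auto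
    also have "\<dots> \<le> (\<Sum>k\<in>I. d k powr s)"
      using Suc.prems(1) k by (intro member_le_sum) auto
    finally show ?thesis .
  next
    case False
    define I' where "I' = (\<lambda>j. {k \<in> I. U k \<inter> \<phi> j ` C \<noteq> {}})"
    have fin': "finite (I' j)" for j using Suc.prems(1) by (simp add: I'_def)
    have d_pos: "0 < d k" if "k \<in> I" for k
    proof -
      have "0 < \<delta> * hi ^ Suc n" using \<delta>_pos hi_pos by simp
      then show ?thesis using Suc.prems(4)[OF that] by linarith
    qed
    have disj: "I' i \<inter> I' j = {}" if ij: "i \<in> J" "j \<in> J" "i \<noteq> j" for i j
    proof (rule ccontr)
      assume "I' i \<inter> I' j \<noteq> {}"
      then obtain k x y where k: "k \<in> I" "x \<in> C" "y \<in> C" "\<phi> i x \<in> U k" "\<phi> j y \<in> U k"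
        unfolding I'_def by blast
      then show False
        using sep[OF ij k(2,3)] Suc.prems(3)[OF k(1,4,5)] False by force
    qed
    have piece: "q j powr s * \<delta> powr s \<le> (\<Sum>k\<in>I' j. d k powr s)" if j: "j \<in> J" for j
    proof -
      have "\<delta> powr s \<le> (\<Sum>k\<in>I' j. (d k / q j) powr s)"
      proof (rule Suc.IH[where U = "\<lambda>k. \<phi> j -` U k"])
        show "C \<subseteq> (\<Union>k\<in>I' j. \<phi> j -` U k)"
        proof
          fix x assume x: "x \<in> C"
          then have "\<phi> j x \<in> C" using \<phi>_in_C j by blast
          then obtain k where "k \<in> I" "\<phi> j x \<in> U k" using Suc.prems(2) by blast
          then show "x \<in> (\<Union>k\<in>I' j. \<phi> j -` U k)" using x unfolding I'_def by blast
        qed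
        fix k assume "k \<in> I' j"
        then have k: "k \<in> I" by (simp add: I'_def)
        show "dist x y \<le> d k / q j" if "x \<in> \<phi> j -` U k" "y \<in> \<phi> j -` U k" for x y
          using Suc.prems(3)[OF k, of "\<phi> j x" "\<phi> j y"] that q_pos[OF j]
          by (simp add: dist_\<phi>[OF j] field_simps)
        have "\<delta> * hi ^ n * q j \<le> \<delta> * hi ^ n * hi"
          using hi(2)[OF j] \<delta>_pos hi_pos by (intro mult_left_mono) auto
        also have "\<dots> \<le> d k" using Suc.prems(4)[OF k] by (simp add: mult_ac)
        finally show "\<delta> * hi ^ n \<le> d k / q j"
          using q_pos[OF j] by (simp add: field_simps)
      qed (rule fin')
      then have "q j powr s * \<delta> powr s \<le> q j powr s * (\<Sum>k\<in>I' j. (d k / q j) powr s)"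
        by (intro mult_left_mono) auto
      also have "\<dots> = (\<Sum>k\<in>I' j. d k powr s)"
        unfolding sum_distrib_left
      proof (rule sum.cong[OF refl])
        fix k assume "k \<in> I' j"
        then have "0 < d k" by (intro d_pos) (simp add: I'_def)
        then show "q j powr s * (d k / q j) powr s = d k powr s"
          using q_pos[OF j] by (subst powr_mult[symmetric]) auto
      qed
      finally show ?thesis .
    qed
    have "\<delta> powr s = (\<Sum>j\<in>J. q j powr s * \<delta> powr s)"
      by (simp add: moran sum_distrib_right[symmetric])
    also have "\<dots> \<le> (\<Sum>j\<in>J. \<Sum>k\<in>I' j. d k powr s)"
      by (rule sum_mono) (rule piece)
    also have "\<dots> = (\<Sum>k\<in>(\<Union>j\<in>J. I' j). d k powr s)"
      by (rule sum.UNION_disjoint[symmetric]) (use finite_J fin' disj in auto)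
    also have "\<dots> \<le> (\<Sum>k\<in>I. d k powr s)"
      using Suc.prems(1) by (intro sum_mono2) (auto simp: I'_def)
    finally show ?thesis .
  qed
qed

text \<open>Slight open enlargements and compactness turn a countable cover into a finite one. Its
  finitely many bounds \<open>d i\<close> are positive, so all exceed
  \<open>\<delta> * hi ^ n\<close> for some \<open>n\<close>, as \<open>finite_cover_sum_ge\<close>
  demands.\<close>

lemma hausdorff_outer_ge: "ennreal (\<delta> powr s) \<le> hausdorff_outer s C"
proof -
  \<comment> \<open>The mesh 1 is arbitrary: the outer measure dominates
    \<open>hausdorff_delta\<close> at every positive mesh.\<close>
  have "ennreal (\<delta> powr s) \<le> hausdorff_delta 1 s C"
    unfolding hausdorff_delta_def
  proof (rule INF_greatest)
    fix E :: "nat \<Rightarrow> 'a set"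
    assume "E \<in> {E. C \<subseteq> (\<Union>i. E i) \<and> (\<forall>i. bounded (E i) \<and> diameter (E i) \<le> 1)}"
    then have cov: "C \<subseteq> (\<Union>i. E i)" and bd: "\<And>i. bounded (E i)" by auto
    show "ennreal (\<delta> powr s) \<le> (\<Sum>i. diam_pow s (E i))"
    proof (rule ennreal_le_epsilon)
      fix e :: real assume e: "0 < e"
      \<comment> \<open>Empty sets are discarded because they cost 0, whereas an enlargement with
        positive \<open>d\<close> would cost 1 when \<open>s = 0\<close>.\<close>
      define N where "N = {i. E i \<noteq> {}}"
      have "\<forall>i\<in>N. \<exists>V d. open V \<and> E i \<subseteq> V \<and> 0 < d \<and> (\<forall>x\<in>V. \<forall>y\<in>V. dist x y \<le> d) \<and>
          ennreal (d powr s) \<le> diam_pow s (E i) + ennreal (e * (1/2)^Suc i)"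
        using e by (intro ballI diam_pow_open_enlargement bd s_nonneg) (auto simp: N_def)
      then obtain V d where V: "\<forall>i\<in>N. open (V i) \<and> E i \<subseteq> V i \<and> 0 < d i \<and>
          (\<forall>x\<in>V i. \<forall>y\<in>V i. dist x y \<le> d i) \<and>
          ennreal (d i powr s) \<le> diam_pow s (E i) + ennreal (e * (1/2)^Suc i)"
        unfolding bchoice_iff by blast
      have "C \<subseteq> (\<Union>i\<in>N. V i)"
      proof
        fix x assume "x \<in> C"
        then obtain i where "x \<in> E i" using cov by blast
        moreover from this have "i \<in> N" by (auto simp: N_def)
        ultimately show "x \<in> (\<Union>i\<in>N. V i)" using V by blast
      qed
      then obtain I where I: "I \<subseteq> N" "finite I" "C \<subseteq> (\<Union>i\<in>I. V i)"
        using compactE_image[OF compact_C, of N V] V by blast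
      have IN: "i \<in> N" if "i \<in> I" for i using I that by blast
      have I_ne: "I \<noteq> {}" using I C_ne by blast
      have "(\<lambda>n. \<delta> * hi ^ n) \<longlonglongrightarrow> \<delta> * 0"
        using hi_pos hi by (intro tendsto_intros LIMSEQ_power_zero) auto
      then have "\<forall>\<^sub>F n in sequentially. \<delta> * hi ^ n < Min (d ` I)"
        using I I_ne V IN by (intro order_tendstoD(2)) auto
      then obtain n where "\<delta> * hi ^ n < Min (d ` I)"
        by (auto simp: eventually_sequentially)
      then have n: "\<delta> * hi ^ n \<le> d i" if "i \<in> I" for i
        using I that by (meson Min_le finite_imageI image_eqI less_imp_le order_trans)
      have "\<delta> powr s \<le> (\<Sum>i\<in>I. d i powr s)"
        by (rule finite_cover_sum_ge[OF I(2,3) _ n]) (use V IN in auto)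
      then have "ennreal (\<delta> powr s) \<le> (\<Sum>i\<in>I. ennreal (d i powr s))"
        by (simp add: sum_ennreal ennreal_leI)
      also have "\<dots> \<le> (\<Sum>i\<in>I. diam_pow s (E i) + ennreal (e * (1/2)^Suc i))"
        using V IN by (intro sum_mono) auto
      also have "\<dots> \<le> (\<Sum>i. diam_pow s (E i) + ennreal (e * (1/2)^Suc i))"
        using I(2) by (intro sum_le_suminf) auto
      also have "\<dots> = (\<Sum>i. diam_pow s (E i)) + (\<Sum>i. ennreal (e * (1/2)^Suc i))"
        by (simp add: suminf_add)
      also have "(\<Sum>i. ennreal (e * (1/2)^Suc i)) = ennreal e"
        using sums_mult[OF power_half_series, of e] e
        by (intro suminf_ennreal_eq) (auto simp: power_divide)
      finally show "ennreal (\<delta> powr s) \<le> (\<Sum>i. diam_pow s (E i)) + ennreal e" .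
    qed
  qed
  also have "\<dots> \<le> hausdorff_outer s C" by (rule hausdorff_delta_le_outer) simp
  finally show ?thesis .
qed

lemma hausdorff_outer_pos: "0 < hausdorff_outer s C"
proof -
  have "0 < ennreal (\<delta> powr s)" using \<delta>_pos by simp
  then show ?thesis using hausdorff_outer_ge by (rule less_le_trans)
qed

lemma hausdorff_dim_eq: "hausdorff_dim C = s"
  using s_nonneg hausdorff_outer_finite hausdorff_outer_pos by (intro hausdorff_dim_eqI) auto

section \<open>Small copies of C around a point\<close>

text \<open>Descend through the pieces containing \<open>x\<close> and stop once the ratio falls
  below \<open>t\<close>; the last factor is at least \<open>lo\<close>, so the ratio cannot drop
  below \<open>lo * t\<close>. At every level the gap \<delta>, scaled by the ratio reached so far,
  keeps the other pieces away from \<open>x\<close>.\<close>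

lemma zoom:
  assumes "x \<in> C" "0 < t" "t \<le> 1"
  shows "\<exists>\<psi> \<rho>. similarity_on \<rho> UNIV \<psi> \<and> lo * t \<le> \<rho> \<and> \<rho> \<le> t \<and> x \<in> \<psi> ` C \<and> \<psi> ` C \<subseteq> C \<and>
    C \<inter> ball x (\<delta> * \<rho>) \<subseteq> \<psi> ` C"
proof -
  \<comment> \<open>The condition \<open>hi ^ n < t\<close> bounds the number of levels by
    \<open>n\<close>. The induction varies \<open>x\<close> and \<open>t\<close>, since removing the
    outermost map replaces them by the preimage of \<open>x\<close> and by \<open>t / q i\<close>;
    for \<open>n = 0\<close> the condition contradicts \<open>t \<le> 1\<close>.\<close>
  have *: "\<exists>\<psi> \<rho>. similarity_on \<rho> UNIV \<psi> \<and> lo * t \<le> \<rho> \<and> \<rho> \<le> t \<and> x \<in> \<psi> ` C \<and> \<psi> ` C \<subseteq> C \<and>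
      C \<inter> ball x (\<delta> * \<rho>) \<subseteq> \<psi> ` C" if "x \<in> C" "t \<le> 1" "hi ^ n < t" for n x t
    using that
  proof (induction n arbitrary: x t)
    case (Suc n)
    have t0: "0 < t" using Suc.prems(3) hi_pos by (meson less_trans zero_less_power)
    obtain i y where i: "i \<in> J" "y \<in> C" "x = \<phi> i y" using Suc.prems(1) C_eq by blast
    note qi = q_pos[OF i(1)] q_less_1[OF i(1)]
    have local: "C \<inter> ball x (\<delta> * \<rho>) \<subseteq> \<phi> i ` C" if "\<rho> \<le> 1" for \<rho>
    proof
      fix z assume z: "z \<in> C \<inter> ball x (\<delta> * \<rho>)"
      then obtain j w where j: "j \<in> J" "w \<in> C" "z = \<phi> j w" using C_eq by blast
      have "\<delta> * \<rho> \<le> \<delta> * 1" using that \<delta>_pos by (intro mult_left_mono) auto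
      then have "dist x z < \<delta>" using z by auto
      then have "i = j" using sep[OF i(1) j(1) _ i(2) j(2)] i(3) j(3) by force
      then show "z \<in> \<phi> i ` C" using j by blast
    qed
    show ?case
    proof (cases "q i < t")
      case True
      have "lo * t \<le> q i"
        using lo(2)[OF i(1)] lo(1) Suc.prems(2) t0 by (meson less_imp_le mult_left_le order_trans)
      then show ?thesis
        using True i sim[OF i(1)] \<phi>_in_C[OF i(1)] local[of "q i"] qi
        by (intro exI[of _ "\<phi> i"] exI[of _ "q i"]) auto
    next
      case False
      have "hi ^ n * q i \<le> hi ^ n * hi"
        using hi(2)[OF i(1)] hi_pos by (intro mult_left_mono) auto
      also have "\<dots> < t" using Suc.prems(3) by (simp add: mult.commute)
      finally have "hi ^ n < t / q i" using qi by (simp add: field_simps)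
      moreover have "t / q i \<le> 1" using False qi by (simp add: field_simps)
      ultimately obtain \<psi> \<rho> where \<psi>: "similarity_on \<rho> UNIV \<psi>" "lo * (t / q i) \<le> \<rho>" "\<rho> \<le> t / q i"
          "y \<in> \<psi> ` C" "\<psi> ` C \<subseteq> C" "C \<inter> ball y (\<delta> * \<rho>) \<subseteq> \<psi> ` C"
        using Suc.IH[OF i(2), of "t / q i"] by blast
      have \<rho>: "lo * t \<le> q i * \<rho>" "q i * \<rho> \<le> t"
        using \<psi>(2,3) qi by (auto simp: field_simps)
      show ?thesis
      proof (intro exI conjI)
        show "similarity_on (q i * \<rho>) UNIV (\<phi> i \<circ> \<psi>)"
          by (rule similarity_on_comp[OF sim[OF i(1)] \<psi>(1)])
        show "x \<in> (\<phi> i \<circ> \<psi>) ` C" using \<psi>(4) i by auto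
        show "(\<phi> i \<circ> \<psi>) ` C \<subseteq> C" using \<psi>(5) \<phi>_in_C[OF i(1)] by auto
        show "C \<inter> ball x (\<delta> * (q i * \<rho>)) \<subseteq> (\<phi> i \<circ> \<psi>) ` C"
        proof
          fix z assume z: "z \<in> C \<inter> ball x (\<delta> * (q i * \<rho>))"
          then obtain w where w: "w \<in> C" "z = \<phi> i w"
            using local[of "q i * \<rho>"] \<rho> Suc.prems(2) by auto
          have "q i * dist y w < q i * (\<delta> * \<rho>)"
            using z w i by (simp add: dist_\<phi>[OF i(1)] mult_ac)
          then have "w \<in> C \<inter> ball y (\<delta> * \<rho>)" using w qi by simp
          then show "z \<in> (\<phi> i \<circ> \<psi>) ` C" using \<psi>(6) w by auto
        qed
      qed (use \<rho> in auto)
    qed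
  qed simp
  have "(\<lambda>n. hi ^ n) \<longlonglongrightarrow> 0"
    using hi_pos hi by (intro LIMSEQ_power_zero) auto
  then have "\<forall>\<^sub>F n in sequentially. hi ^ n < t"
    using assms by (intro order_tendstoD(2)) auto
  then obtain n where "hi ^ n < t" by (auto simp: eventually_sequentially)
  then show ?thesis by (rule *[OF assms(1,3)])
qed

text \<open>A copy of \<open>C\<close> through \<open>x\<close> with ratio at most
  \<open>e / (diameter C + 1)\<close> fits into the ball, and the scaling law gives it positive
  measure.\<close>

lemma hausdorff_outer_ball_pos:
  assumes "x \<in> C" "0 < e"
  shows "0 < hausdorff_outer s (C \<inter> ball x e)"
proof -
  let ?D = "diameter C + 1"
  have D: "0 < ?D" using diameter_ge_0[OF compact_imp_bounded[OF compact_C]] by simp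
  obtain \<psi> \<rho> where \<psi>: "similarity_on \<rho> UNIV \<psi>" "\<rho> \<le> min 1 (e / ?D)" "x \<in> \<psi> ` C" "\<psi> ` C \<subseteq> C"
    using zoom[OF assms(1), of "min 1 (e / ?D)"] assms(2) D by auto
  obtain y where y: "y \<in> C" "x = \<psi> y" using \<psi>(3) by blast
  have \<rho>: "0 < \<rho>" using \<psi>(1) by (simp add: similarity_on_def)
  have "\<psi> ` C \<subseteq> C \<inter> ball x e"
  proof
    fix z assume "z \<in> \<psi> ` C"
    then obtain w where w: "w \<in> C" "z = \<psi> w" by blast
    have "dist x z = \<rho> * dist y w" using \<psi>(1) y w by (simp add: similarity_on_def)
    also have "\<dots> \<le> \<rho> * diameter C"
      using y w \<rho> by (intro mult_left_mono diameter_bounded_bound compact_imp_bounded compact_C) auto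
    also have "\<dots> < \<rho> * ?D" using \<rho> by simp
    also have "\<dots> \<le> e" using \<psi>(2) D by (simp add: field_simps)
    finally show "z \<in> C \<inter> ball x e" using \<psi>(4) w by auto
  qed
  then have "hausdorff_outer s (\<psi> ` C) \<le> hausdorff_outer s (C \<inter> ball x e)"
    by (rule hausdorff_outer_mono)
  moreover have "hausdorff_outer s (\<psi> ` C) = ennreal (\<rho> powr s) * hausdorff_outer s C"
    by (rule hausdorff_outer_similarity_image[OF similarity_on_subset[OF \<psi>(1)] s_nonneg]) simp
  moreover have "0 < ennreal (\<rho> powr s) * hausdorff_outer s C"
    using \<rho> hausdorff_outer_pos by (simp add: ennreal_zero_less_mult_iff)
  ultimately show ?thesis by simp
qed

section \<open>Magnifications and their limits\<close>

abbreviation restr :: "'a set \<Rightarrow> 'a measure" where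
  "restr A \<equiv> measure_restr (hausdorff_measure s) A"

definition magnified :: "'a \<Rightarrow> real \<Rightarrow> 'a set" where
  "magnified x r = (\<lambda>y. (1 / r) *\<^sub>R y) ` recenter C x"

lemma magnified_eq: "magnified x r = (\<lambda>y. (y - x) /\<^sub>R r) ` C"
  by (simp add: magnified_def recenter_def image_image divide_inverse)

lemma similarity_magnify:
  "0 < r \<Longrightarrow> similarity_on (1 / r) S (\<lambda>y::'a. (y - x) /\<^sub>R r)"
  by (simp add: similarity_on_def dist_norm divide_inverse
      flip: scaleR_diff_right)

lemma compact_magnified: "compact (magnified x r)"
  unfolding magnified_eq by (intro compact_continuous_image continuous_intros compact_C)

lemma borel_magnified: "magnified x r \<in> sets borel"
  by (intro borel_closed compact_imp_closed compact_magnified)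

lemma zero_in_magnified: "x \<in> C \<Longrightarrow> 0 \<in> magnified x r"
  unfolding magnified_eq by (rule image_eqI[of _ _ x]) auto

lemma emeasure_restr: "A \<in> sets borel \<Longrightarrow> B \<in> sets borel \<Longrightarrow> emeasure (restr A) B = hausdorff_outer s (A \<inter> B)"
  by (rule emeasure_measure_restr_hausdorff)

lemma finite_measure_restr_C: "finite_measure (restr C)"
proof
  show "emeasure (restr C) (space (restr C)) \<noteq> \<infinity>"
    using emeasure_restr[OF borel_C, of UNIV] hausdorff_outer_finite
      sets_eq_imp_space_eq[OF sets_measure_restr, of "hausdorff_measure s" C]
    by simp
qed

lemma integral_similarity_image:
  fixes f :: "'a \<Rightarrow> real"
  assumes \<psi>: "\<psi> \<in> borel_measurable borel" "similarity_on \<rho> C \<psi>" and f: "f \<in> borel_measurable borel"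
  shows "(\<integral>y. f y \<partial>restr (\<psi> ` C)) = \<rho> powr s * (\<integral>y. f (\<psi> y) \<partial>restr C)"
proof -
  have m: "\<psi> \<in> measurable (restr C) borel"
    using \<psi>(1) by (simp cong: measurable_cong_sets)
  show ?thesis
    unfolding measure_restr_similarity_image[OF compact_C \<psi> s_nonneg]
    using f by (subst integral_scale_measure) (auto simp: integral_distr[OF m f])
qed

text \<open>\<open>blow_up\<close> transports mass without rescaling it, whereas H^s of the
  magnified set carries the factor \<open>(1 / r) powr s\<close>. The discrepancy
  \<open>r powr s\<close> is absorbed later by the constants of the tangent measure.\<close>

lemma integral_blow_up:
  fixes f :: "'a \<Rightarrow> real"
  assumes "0 < r" "f \<in> borel_measurable borel"
  shows "(\<integral>y. f y \<partial>blow_up (restr C) x r) = r powr s * (\<integral>y. f y \<partial>restr (magnified x r))"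
proof -
  let ?\<psi> = "\<lambda>y. (y - x) /\<^sub>R r"
  have b: "?\<psi> \<in> borel_measurable borel" by measurable
  then have m: "?\<psi> \<in> measurable (restr C) borel" by (simp cong: measurable_cong_sets)
  have "(\<integral>y. f y \<partial>restr (magnified x r)) = (1 / r) powr s * (\<integral>y. f (?\<psi> y) \<partial>restr C)"
    unfolding magnified_eq
    by (rule integral_similarity_image[OF b similarity_magnify[OF assms(1)] assms(2)])
  moreover have "(\<integral>y. f y \<partial>blow_up (restr C) x r) = (\<integral>y. f (?\<psi> y) \<partial>restr C)"
    unfolding blow_up_def by (rule integral_distr[OF m assms(2)])
  ultimately show ?thesis using assms(1) by (simp add: powr_divide)
qed

lemma magnified_local:
  assumes x: "x \<in> C" and R: "0 < R" and r: "0 < r" "r * R \<le> \<delta> * lo"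
  shows "\<exists>\<psi> \<rho>. similarity_on \<rho> UNIV \<psi> \<and> R / \<delta> \<le> \<rho> \<and> \<rho> \<le> R / (\<delta> * lo) \<and> 0 \<in> \<psi> ` C \<and>
    magnified x r \<inter> ball 0 R = \<psi> ` C \<inter> ball 0 R"
proof -
  \<comment> \<open>Chosen so that \<open>\<delta> * (lo * t) = r * R\<close>: the copy given by
    \<open>zoom\<close> then contains all of \<open>C\<close> in the ball of radius
    \<open>r * R\<close> around \<open>x\<close>, and after magnification its ratio has bounds
    independent of \<open>r\<close>.\<close>
  define t where "t = r * R / (\<delta> * lo)"
  have t: "0 < t" "t \<le> 1" using R r \<delta>_pos lo(1) by (auto simp: t_def)
  obtain \<psi> \<rho> where \<psi>: "similarity_on \<rho> UNIV \<psi>" "lo * t \<le> \<rho>" "\<rho> \<le> t" "x \<in> \<psi> ` C" "\<psi> ` C \<subseteq> C"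
      "C \<inter> ball x (\<delta> * \<rho>) \<subseteq> \<psi> ` C"
    using zoom[OF x t] by blast
  let ?\<psi> = "(\<lambda>y. (y - x) /\<^sub>R r) \<circ> \<psi>"
  have scale: "r * R \<le> \<delta> * \<rho>"
    using mult_left_mono[OF \<psi>(2), of \<delta>] \<delta>_pos lo(1) by (simp add: t_def)
  show ?thesis
  proof (intro exI conjI)
    show "similarity_on (1 / r * \<rho>) UNIV ?\<psi>"
      by (rule similarity_on_comp[OF similarity_magnify[OF r(1)] \<psi>(1)])
    show "R / \<delta> \<le> 1 / r * \<rho>" using scale r \<delta>_pos by (simp add: field_simps)
    show "1 / r * \<rho> \<le> R / (\<delta> * lo)" using \<psi>(3) r by (simp add: t_def field_simps)
    show "0 \<in> ?\<psi> ` C" using \<psi>(4) by force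
    show "magnified x r \<inter> ball 0 R = ?\<psi> ` C \<inter> ball 0 R"
    proof (intro equalityI subsetI)
      fix z assume z: "z \<in> magnified x r \<inter> ball 0 R"
      then obtain y where y: "y \<in> C" "z = (y - x) /\<^sub>R r" unfolding magnified_eq by blast
      have "y - x = r *\<^sub>R z" using y r by simp
      then have "norm (y - x) < r * R" using z r by simp
      then have "y \<in> ball x (\<delta> * \<rho>)" using scale by (simp add: dist_norm norm_minus_commute)
      then have "y \<in> \<psi> ` C" using \<psi>(6) y by blast
      then show "z \<in> ?\<psi> ` C \<inter> ball 0 R" using z y by auto
    next
      fix z assume "z \<in> ?\<psi> ` C \<inter> ball 0 R"
      then show "z \<in> magnified x r \<inter> ball 0 R"
        using \<psi>(5) unfolding magnified_eq by auto
    qed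
  qed
qed

text \<open>Inside a fixed ball all sufficiently small magnifications are similar copies of \<open>C\<close>, with ratios in a
  compact interval and base points in a bounded set, so Arzela-Ascoli gives a limiting copy.\<close>

lemma limit_structure:
  assumes x: "x \<in> C" and R: "0 < R" and r: "\<And>k. 0 < r k" "r \<longlonglongrightarrow> 0"
    and lim: "limitin hit_miss_topology (\<lambda>k. magnified x (r k)) F sequentially"
  shows "\<exists>\<sigma> \<psi> \<rho> g l. strict_mono \<sigma> \<and> (\<forall>k. similarity_on (\<rho> k) UNIV (\<psi> k)) \<and>
    (\<forall>k. magnified x (r (\<sigma> k)) \<inter> ball 0 R = \<psi> k ` C \<inter> ball 0 R) \<and>
    \<rho> \<longlonglongrightarrow> l \<and> uniform_limit C \<psi> g sequentially \<and> similarity_on l C g \<and>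
    F \<inter> ball 0 R = g ` C \<inter> ball 0 R"
proof -
  have "(\<lambda>k. r k * R) \<longlonglongrightarrow> 0 * R" using r by (intro tendsto_intros)
  then have "\<forall>\<^sub>F k in sequentially. r k * R < \<delta> * lo"
    using \<delta>_pos lo(1) by (intro order_tendstoD(2)) auto
  \<comment> \<open>\<open>magnified_local\<close> needs \<open>r k\<close> to be small compared
    with \<open>R\<close>, so the sequence is shifted by \<open>N\<close>.\<close>
  then obtain N where N: "\<And>k. N \<le> k \<Longrightarrow> r k * R \<le> \<delta> * lo"
    by (force simp: eventually_sequentially)
  have "\<forall>k. \<exists>\<psi> \<rho>. similarity_on \<rho> UNIV \<psi> \<and> R / \<delta> \<le> \<rho> \<and> \<rho> \<le> R / (\<delta> * lo) \<and> 0 \<in> \<psi> ` C \<and>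
      magnified x (r (k + N)) \<inter> ball 0 R = \<psi> ` C \<inter> ball 0 R"
    by (intro allI magnified_local x R r N) simp
  then obtain \<psi> \<rho> where "\<forall>k. similarity_on (\<rho> k) UNIV (\<psi> k) \<and> R / \<delta> \<le> \<rho> k \<and>
      \<rho> k \<le> R / (\<delta> * lo) \<and> 0 \<in> \<psi> k ` C \<and> magnified x (r (k + N)) \<inter> ball 0 R = \<psi> k ` C \<inter> ball 0 R"
    unfolding choice_iff by blast
  then have \<psi>: "\<And>k. similarity_on (\<rho> k) UNIV (\<psi> k)" "\<And>k. R / \<delta> \<le> \<rho> k" "\<And>k. \<rho> k \<le> R / (\<delta> * lo)"
      "\<And>k. 0 \<in> \<psi> k ` C" "\<And>k. magnified x (r (k + N)) \<inter> ball 0 R = \<psi> k ` C \<inter> ball 0 R"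
    by simp_all
  let ?b = "R / (\<delta> * lo)"
  have b: "0 < ?b" using R \<delta>_pos lo(1) by simp
  have lip: "dist (\<psi> k y) (\<psi> k z) \<le> ?b * dist y z" for k y z
    using \<psi>(1)[of k] mult_right_mono[OF \<psi>(3)[of k], of "dist y z"]
    by (simp add: similarity_on_def)
  have "bounded (range \<rho>)"
    using \<psi>(2,3) by (intro bounded_subset[OF bounded_closed_interval[of "R / \<delta>" ?b]]) auto
  then obtain l \<sigma>1 where \<sigma>1: "strict_mono (\<sigma>1 :: nat \<Rightarrow> nat)" "(\<rho> \<circ> \<sigma>1) \<longlonglongrightarrow> l"
    using bounded_imp_convergent_subsequence by metis
  \<comment> \<open>Every map sends some point of \<open>C\<close> to 0, so the common Lipschitz
    constant \<open>?b\<close> also bounds all maps on \<open>C\<close>.\<close>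
  have norm_le: "norm (\<psi> (\<sigma>1 k) y) \<le> ?b * diameter C" if y: "y \<in> C" for k y
  proof -
    obtain p where p: "p \<in> C" "\<psi> (\<sigma>1 k) p = 0" using \<psi>(4)[of "\<sigma>1 k"] by force
    have "norm (\<psi> (\<sigma>1 k) y) \<le> ?b * dist y p" using lip[of "\<sigma>1 k" y p] p by simp
    also have "\<dots> \<le> ?b * diameter C"
      using y p b by (intro mult_left_mono diameter_bounded_bound compact_imp_bounded compact_C) auto
    finally show ?thesis .
  qed
  have equi: "\<exists>d. 0 < d \<and> (\<forall>k z. z \<in> C \<and> norm (y - z) < d \<longrightarrow> norm (\<psi> (\<sigma>1 k) y - \<psi> (\<sigma>1 k) z) < e)"
    if e: "0 < e" for y e
  proof (intro exI[of _ "e / ?b"] conjI allI impI)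
    show "0 < e / ?b" by (rule divide_pos_pos[OF e b])
    fix k z assume "z \<in> C \<and> norm (y - z) < e / ?b"
    then have "norm (y - z) < e / ?b" by simp
    then have "?b * norm (y - z) < e" by (subst (asm) pos_less_divide_eq[OF b]) (simp only: mult.commute)
    then show "norm (\<psi> (\<sigma>1 k) y - \<psi> (\<sigma>1 k) z) < e"
      using lip[of "\<sigma>1 k" y z] by (simp add: dist_norm)
  qed
  obtain g \<sigma>2 where g: "continuous_on C g" and \<sigma>2: "strict_mono (\<sigma>2 :: nat \<Rightarrow> nat)"
      and conv: "\<And>e. 0 < e \<Longrightarrow> \<exists>N. \<forall>n x. n \<ge> N \<and> x \<in> C \<longrightarrow> norm (\<psi> (\<sigma>1 (\<sigma>2 n)) x - g x) < e"
    using Arzela_Ascoli[OF compact_C norm_le equi] by metis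
  let ?\<tau> = "\<sigma>1 \<circ> \<sigma>2"
  let ?\<sigma> = "\<lambda>k. ?\<tau> k + N"
  have mono: "strict_mono ?\<sigma>"
    using strict_mono_o[OF \<sigma>1(1) \<sigma>2] by (simp add: strict_mono_def)
  have unif: "uniform_limit C (\<lambda>k. \<psi> (?\<tau> k)) g sequentially"
    unfolding uniform_limit_iff eventually_sequentially dist_norm
    using conv by (simp add: comp_def) metis
  have \<rho>lim: "(\<lambda>k. \<rho> (?\<tau> k)) \<longlonglongrightarrow> l"
    using LIMSEQ_subseq_LIMSEQ[OF \<sigma>1(2) \<sigma>2] by (simp add: comp_def)
  \<comment> \<open>The uniform lower bound on the ratios prevents the limit map from collapsing to
    a constant.\<close>
  have "R / \<delta> \<le> l"
    by (rule tendsto_lowerbound[OF \<rho>lim]) (use \<psi>(2) in auto)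
  moreover have "0 < R / \<delta>" using R \<delta>_pos by simp
  ultimately have l: "0 < l" by linarith
  have ptw: "(\<lambda>k. \<psi> (?\<tau> k) y) \<longlonglongrightarrow> g y" if "y \<in> C" for y
    using tendsto_uniform_limitI[OF unif that] .
  have simg: "similarity_on l C g"
    unfolding similarity_on_def
  proof (intro conjI ballI l)
    fix y z assume yz: "y \<in> C" "z \<in> C"
    have "(\<lambda>k. dist (\<psi> (?\<tau> k) y) (\<psi> (?\<tau> k) z)) \<longlonglongrightarrow> dist (g y) (g z)"
      by (intro tendsto_dist ptw yz)
    moreover have "dist (\<psi> (?\<tau> k) y) (\<psi> (?\<tau> k) z) = \<rho> (?\<tau> k) * dist y z" for k
      using \<psi>(1)[of "?\<tau> k"] unfolding similarity_on_def by blast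
    ultimately have "(\<lambda>k. \<rho> (?\<tau> k) * dist y z) \<longlonglongrightarrow> dist (g y) (g z)" by simp
    moreover have "(\<lambda>k. \<rho> (?\<tau> k) * dist y z) \<longlonglongrightarrow> l * dist y z"
      by (intro tendsto_intros \<rho>lim)
    ultimately show "dist (g y) (g z) = l * dist y z" by (rule LIMSEQ_unique)
  qed
  have lim': "limitin hit_miss_topology (\<lambda>k. magnified x (r (?\<sigma> k))) F sequentially"
    using limitin_subsequence[OF mono lim] by (simp add: comp_def)
  have loc: "magnified x (r (?\<sigma> k)) \<inter> ball 0 R = \<psi> (?\<tau> k) ` C \<inter> ball 0 R" for k
    by (rule \<psi>(5))
  have "F \<inter> ball 0 R = g ` C \<inter> ball 0 R"
    by (rule limitin_hit_miss_local[OF lim' _ loc unif])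
      (auto intro: compact_imp_closed compact_magnified compact_continuous_image g compact_C)
  then show ?thesis
    using mono loc \<psi>(1) \<rho>lim unif simg
    by (intro exI[of _ ?\<sigma>] exI[of _ "\<lambda>k. \<psi> (?\<tau> k)"] exI[of _ "\<lambda>k. \<rho> (?\<tau> k)"] exI[of _ g] exI[of _ l]) simp
qed

lemma limit_borel:
  assumes "limitin hit_miss_topology X F sequentially"
  shows "F \<in> sets (borel :: 'a measure)"
  using limitin_topspace[OF assms] by (simp add: topspace_hit_miss_topology)

lemma zero_in_limit:
  assumes x: "x \<in> C" and lim: "limitin hit_miss_topology (\<lambda>k. magnified x (r k)) F sequentially"
  shows "0 \<in> F"
proof (rule ccontr)
  assume "0 \<notin> F"
  then have "\<forall>\<^sub>F k in sequentially. magnified x (r k) \<inter> {0} = {}"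
    using lim[unfolded limitin_hit_miss_iff[OF compact_imp_closed[OF compact_magnified]]]
    by (metis Int_insert_right_if0 compact_insert compact_empty inf_bot_right)
  then show False
    using zero_in_magnified[OF x] by simp
qed

lemma restr_limit_finite:
  assumes x: "x \<in> C" and r: "\<And>k. 0 < r k" "r \<longlonglongrightarrow> 0"
    and lim: "limitin hit_miss_topology (\<lambda>k. magnified x (r k)) F sequentially"
    and K: "compact K"
  shows "emeasure (restr F) K < \<infinity>"
proof -
  obtain R where R: "0 < R" "K \<subseteq> ball 0 R"
    using bounded_subset_ballD[OF compact_imp_bounded[OF K]] by blast
  obtain g l where g: "similarity_on l C g" "F \<inter> ball 0 R = g ` C \<inter> ball 0 R"
    using limit_structure[OF x R(1) r lim] by blast
  have "emeasure (restr F) K = hausdorff_outer s (F \<inter> K)"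
    using K limit_borel[OF lim] by (intro emeasure_restr) (auto intro: borel_closed compact_imp_closed)
  also have "\<dots> \<le> hausdorff_outer s (g ` C)"
    using R g(2) by (intro hausdorff_outer_mono) blast
  also have "\<dots> = ennreal (l powr s) * hausdorff_outer s C"
    by (rule hausdorff_outer_similarity_image[OF g(1) s_nonneg])
  also have "\<dots> < \<infinity>"
    using hausdorff_outer_finite by (simp add: ennreal_mult_less_top)
  finally show ?thesis .
qed

text \<open>Near 0, the set \<open>F\<close> contains a similar image of a piece of \<open>C\<close>
  around the point \<open>p\<close> that the limit map sends to 0, and that piece has positive
  measure.\<close>

lemma restr_limit_nonzero:
  assumes x: "x \<in> C" and r: "\<And>k. 0 < r k" "r \<longlonglongrightarrow> 0"
    and lim: "limitin hit_miss_topology (\<lambda>k. magnified x (r k)) F sequentially"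
  shows "emeasure (restr F) UNIV \<noteq> 0"
proof -
  obtain g l where g: "similarity_on l C g" "F \<inter> ball 0 1 = g ` C \<inter> ball 0 1"
    using limit_structure[OF x zero_less_one r lim] by blast
  have l: "0 < l" using g by (simp add: similarity_on_def)
  obtain p where p: "p \<in> C" "g p = 0"
    using zero_in_limit[OF x lim] g(2) by force
  have "g ` (C \<inter> ball p (1 / l)) \<subseteq> F"
  proof
    fix z assume "z \<in> g ` (C \<inter> ball p (1 / l))"
    then obtain y where y: "y \<in> C" "dist p y < 1 / l" "z = g y" by auto
    have "dist 0 z = l * dist p y" using g(1) p y by (metis similarity_on_def)
    then have "z \<in> ball 0 1" using y l by (simp add: field_simps)
    then show "z \<in> F" using g(2) y by blast
  qed
  then have "hausdorff_outer s (g ` (C \<inter> ball p (1 / l))) \<le> hausdorff_outer s F"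
    by (rule hausdorff_outer_mono)
  moreover have "hausdorff_outer s (g ` (C \<inter> ball p (1 / l)))
      = ennreal (l powr s) * hausdorff_outer s (C \<inter> ball p (1 / l))"
    by (rule hausdorff_outer_similarity_image[OF similarity_on_subset[OF g(1)] s_nonneg]) simp
  moreover have "0 < ennreal (l powr s) * hausdorff_outer s (C \<inter> ball p (1 / l))"
    using l hausdorff_outer_ball_pos[OF p(1), of "1 / l"] by (simp add: ennreal_zero_less_mult_iff)
  ultimately show ?thesis
    using emeasure_restr[OF limit_borel[OF lim], of UNIV] by auto
qed

text \<open>The varying measures are pulled back to the single finite measure on \<open>C\<close>.
  There only the integrands vary, and dominated convergence applies with a constant
  majorant.\<close>

lemma restr_convergent_subsequence:
  assumes x: "x \<in> C" and r: "\<And>k. 0 < r k" "r \<longlonglongrightarrow> 0"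
    and lim: "limitin hit_miss_topology (\<lambda>k. magnified x (r k)) F sequentially"
    and f: "test_function f"
  shows "\<exists>\<sigma>. strict_mono \<sigma> \<and> (\<lambda>k. \<integral>y. f y \<partial>restr (magnified x (r (\<sigma> k)))) \<longlonglongrightarrow> (\<integral>y. f y \<partial>restr F)"
proof -
  interpret \<mu>: finite_measure "restr C" by (rule finite_measure_restr_C)
  obtain R where R: "0 < R" "\<And>y. y \<notin> ball 0 R \<Longrightarrow> f y = 0"
    using test_function_support[OF f] by blast
  obtain B where B: "0 \<le> B" "\<And>y. \<bar>f y\<bar> \<le> B"
    using test_function_bounded[OF f] by blast
  note fm = test_function_measurable[OF f]
  obtain \<sigma> \<psi> \<rho> g l where \<sigma>: "strict_mono \<sigma>" and sim_\<psi>: "\<forall>k. similarity_on (\<rho> k) UNIV (\<psi> k)"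
      and loc: "\<forall>k. magnified x (r (\<sigma> k)) \<inter> ball 0 R = \<psi> k ` C \<inter> ball 0 R"
      and \<rho>: "\<rho> \<longlonglongrightarrow> l" and unif: "uniform_limit C \<psi> g sequentially" and sim_g: "similarity_on l C g"
      and F: "F \<inter> ball 0 R = g ` C \<inter> ball 0 R"
    using limit_structure[OF x R(1) r lim] by (elim exE conjE) (rule that)
  note sim_\<psi> = sim_\<psi>[rule_format] and loc = loc[rule_format]
  \<comment> \<open>\<open>g\<close> is controlled on \<open>C\<close> only; the extension by 0
    provides a Borel map on the whole space.\<close>
  define G where "G = (\<lambda>y. if y \<in> C then g y else 0)"
  have Gm: "G \<in> borel_measurable borel"
    unfolding G_def
    by (rule borel_measurable_continuous_on_if[OF borel_C similarity_on_continuous[OF sim_g]]) auto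
  have sim_G: "similarity_on l C G" using sim_g by (simp add: G_def similarity_on_def)
  have GC: "G ` C = g ` C" by (simp add: G_def)
  have \<psi>m: "\<psi> k \<in> borel_measurable borel" for k
    using similarity_on_continuous[OF sim_\<psi>] by (rule borel_measurable_continuous_onI)
  have borel_image: "h ` C \<in> sets borel" if "similarity_on t C h" for h :: "'a \<Rightarrow> 'a" and t
    using similarity_on_continuous[OF that] compact_C
    by (intro borel_closed compact_imp_closed compact_continuous_image)
  have sim_\<psi>C: "similarity_on (\<rho> k) C (\<psi> k)" for k
    using sim_\<psi> by (rule similarity_on_subset) simp
  have I: "(\<integral>y. f y \<partial>restr (magnified x (r (\<sigma> k)))) = \<rho> k powr s * (\<integral>y. f (\<psi> k y) \<partial>restr C)" for k
  proof -
    have "(\<integral>y. f y \<partial>restr (magnified x (r (\<sigma> k)))) = (\<integral>y. f y \<partial>restr (\<psi> k ` C))"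
      by (rule integral_measure_restr_cong[where S = "ball 0 R"])
        (use fm R(2) loc borel_magnified borel_image[OF sim_\<psi>C] in \<open>auto cong: measurable_cong_sets\<close>)
    then show ?thesis using integral_similarity_image[OF \<psi>m sim_\<psi>C fm] by simp
  qed
  have IF: "(\<integral>y. f y \<partial>restr F) = l powr s * (\<integral>y. f (G y) \<partial>restr C)"
  proof -
    have "(\<integral>y. f y \<partial>restr F) = (\<integral>y. f y \<partial>restr (G ` C))"
      by (rule integral_measure_restr_cong[where S = "ball 0 R"])
        (use fm R(2) F GC limit_borel[OF lim] borel_image[OF sim_G] in \<open>auto cong: measurable_cong_sets\<close>)
    then show ?thesis using integral_similarity_image[OF Gm sim_G fm] by simp
  qed
  have "(\<lambda>k. \<integral>y. f (\<psi> k y) \<partial>restr C) \<longlonglongrightarrow> (\<integral>y. f (G y) \<partial>restr C)"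
  proof (rule integral_dominated_convergence[where w = "\<lambda>_. B"])
    show "(\<lambda>y. f (G y)) \<in> borel_measurable (restr C)"
      using measurable_compose[OF Gm fm] by (simp cong: measurable_cong_sets)
    show "(\<lambda>y. f (\<psi> k y)) \<in> borel_measurable (restr C)" for k
      using measurable_compose[OF \<psi>m fm] by (simp cong: measurable_cong_sets)
    \<comment> \<open>Pointwise convergence is available on \<open>C\<close> only, so it is stated
      where the density of the restricted measure is positive.\<close>
    have "AE y in hausdorff_measure s. 0 < (indicator C y :: ennreal) \<longrightarrow> (\<lambda>k. f (\<psi> k y)) \<longlonglongrightarrow> f (G y)"
    proof (rule AE_I2, rule impI)
      fix y assume "0 < (indicator C y :: ennreal)"
      then have y: "y \<in> C" by (cases "y \<in> C") auto
      have "(\<lambda>k. \<psi> k y) \<longlonglongrightarrow> G y"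
        using tendsto_uniform_limitI[OF unif y] y by (simp add: G_def)
      moreover have "isCont f (G y)"
        using f by (simp add: test_function_def continuous_on_eq_continuous_at)
      ultimately show "(\<lambda>k. f (\<psi> k y)) \<longlonglongrightarrow> f (G y)"
        by (rule isCont_tendsto_compose[rotated])
    qed
    then show "AE y in restr C. (\<lambda>k. f (\<psi> k y)) \<longlonglongrightarrow> f (G y)"
      unfolding measure_restr_def using borel_C by (subst AE_density) auto
  qed (use B in auto)
  moreover have "(\<lambda>k. \<rho> k powr s) \<longlonglongrightarrow> l powr s"
    using sim_g by (intro tendsto_intros \<rho>) (simp add: similarity_on_def)
  ultimately have "(\<lambda>k. \<rho> k powr s * (\<integral>y. f (\<psi> k y) \<partial>restr C)) \<longlonglongrightarrow> l powr s * (\<integral>y. f (G y) \<partial>restr C)"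
    by (intro tendsto_mult)
  then show ?thesis using \<sigma> by (intro exI[of _ \<sigma>]) (simp add: I IF)
qed

text \<open>Indices that stay away from the limit would form a subsequence whose sets still converge
  to \<open>F\<close>; a further subsequence of integrals would then converge to the same limit, a
  contradiction.\<close>

lemma restr_convergent:
  assumes x: "x \<in> C" and r: "\<And>k. 0 < r k" "r \<longlonglongrightarrow> 0"
    and lim: "limitin hit_miss_topology (\<lambda>k. magnified x (r k)) F sequentially"
    and f: "test_function f"
  shows "(\<lambda>k. \<integral>y. f y \<partial>restr (magnified x (r k))) \<longlonglongrightarrow> (\<integral>y. f y \<partial>restr F)"
proof (rule ccontr)
  let ?I = "\<lambda>k. \<integral>y. f y \<partial>restr (magnified x (r k))" and ?L = "\<integral>y. f y \<partial>restr F"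
  assume "\<not> ?I \<longlonglongrightarrow> ?L"
  then obtain e where e: "0 < e" "\<not> (\<forall>\<^sub>F k in sequentially. dist (?I k) ?L < e)"
    unfolding tendsto_iff by blast
  then have "infinite {k. \<not> dist (?I k) ?L < e}"
    by (simp add: eventually_cofinite flip: cofinite_eq_sequentially)
  then obtain \<sigma> :: "nat \<Rightarrow> nat" where \<sigma>: "strict_mono \<sigma>" "\<forall>k. \<sigma> k \<in> {k. \<not> dist (?I k) ?L < e}"
    using infinite_enumerate[of "{k. \<not> dist (?I k) ?L < e}"] by blast
  have "limitin hit_miss_topology (\<lambda>k. magnified x (r (\<sigma> k))) F sequentially"
    using limitin_subsequence[OF \<sigma>(1) lim] by (simp add: comp_def)
  moreover have "(\<lambda>k. r (\<sigma> k)) \<longlonglongrightarrow> 0"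
    using LIMSEQ_subseq_LIMSEQ[OF r(2) \<sigma>(1)] by (simp add: comp_def)
  ultimately obtain \<tau> where "(\<lambda>k. ?I (\<sigma> (\<tau> k))) \<longlonglongrightarrow> ?L"
    using restr_convergent_subsequence[OF x, of "\<lambda>k. r (\<sigma> k)" F f] r(1) f by blast
  then have "\<forall>\<^sub>F k in sequentially. dist (?I (\<sigma> (\<tau> k))) ?L < e"
    using e(1) by (rule tendstoD)
  then show False using \<sigma>(2) by (auto simp: eventually_sequentially)
qed

lemma limit_models_magnified:
  "limit_models (recenter C x) = {F. \<exists>r. (\<forall>k. 0 < r k) \<and> r \<longlonglongrightarrow> 0 \<and>
     limitin hit_miss_topology (\<lambda>k. magnified x (r k)) F sequentially}"
  by (simp add: limit_models_def magnified_def)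

section \<open>The two inclusions\<close>

lemma tangent_measures_eq:
  assumes x: "x \<in> C"
  shows "tangent_measures (restr C) x =
    {scale_measure (ennreal c) (restr F) |c F. F \<in> limit_models (recenter C x) \<and> 0 < c}"
proof (intro equalityI subsetI)
  fix \<nu> assume "\<nu> \<in> {scale_measure (ennreal c) (restr F) |c F. F \<in> limit_models (recenter C x) \<and> 0 < c}"
  then obtain c F r where \<nu>: "\<nu> = scale_measure (ennreal c) (restr F)" and c: "0 < c"
      and r: "\<And>k. 0 < r k" "r \<longlonglongrightarrow> 0"
      and lim: "limitin hit_miss_topology (\<lambda>k. magnified x (r k)) F sequentially"
    unfolding limit_models_magnified by blast
  have "radon_measure \<nu>"
  proof (rule radon_measureI)
    show "sets \<nu> = sets borel" by (simp add: \<nu>)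
    fix K :: "'a set" assume "compact K"
    then show "emeasure \<nu> K < \<infinity>"
      using restr_limit_finite[OF x r lim, of K] by (simp add: \<nu> ennreal_mult_less_top)
  qed
  moreover have "emeasure \<nu> UNIV \<noteq> 0"
    using restr_limit_nonzero[OF x r lim] c by (simp add: \<nu>)
  \<comment> \<open>The factor \<open>r i powr (- s)\<close> cancels the one from
    \<open>integral_blow_up\<close>.\<close>
  moreover have "(\<lambda>i. c * r i powr (- s) * (\<integral>y. f y \<partial>blow_up (restr C) x (r i))) \<longlonglongrightarrow> (\<integral>y. f y \<partial>\<nu>)"
    if f: "test_function f" for f
  proof -
    note fm = test_function_measurable[OF f]
    have "c * r i powr (- s) * (\<integral>y. f y \<partial>blow_up (restr C) x (r i))
        = c * (\<integral>y. f y \<partial>restr (magnified x (r i)))" for i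
      using r(1)[of i] by (simp add: integral_blow_up[OF r(1) fm] powr_minus)
    moreover have "(\<integral>y. f y \<partial>\<nu>) = c * (\<integral>y. f y \<partial>restr F)"
      unfolding \<nu> using c fm by (intro integral_scale_measure) (auto cong: measurable_cong_sets)
    ultimately show ?thesis
      using tendsto_mult_left[OF restr_convergent[OF x r lim f], of c] by (simp only:)
  qed
  moreover have "0 < c * r i powr (- s)" for i using c r(1)[of i] by simp
  ultimately show "\<nu> \<in> tangent_measures (restr C) x"
    unfolding tangent_measures_def test_function_def mem_Collect_eq
    using r by (intro conjI exI[of _ r] exI[of _ "\<lambda>i. c * r i powr (- s)"]) auto
next
  fix \<nu> assume "\<nu> \<in> tangent_measures (restr C) x"
  then obtain r c where radon: "radon_measure \<nu>" and nz: "emeasure \<nu> UNIV \<noteq> 0"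
      and r: "\<And>i. 0 < r i" "r \<longlonglongrightarrow> 0" and c: "\<And>i. 0 < c i"
      and conv: "\<And>f. test_function f \<Longrightarrow>
        (\<lambda>i. c i * (\<integral>y. f y \<partial>blow_up (restr C) x (r i))) \<longlonglongrightarrow> (\<integral>y. f y \<partial>\<nu>)"
    unfolding tangent_measures_def test_function_def by auto
  have \<nu>_sets: "sets \<nu> = sets borel" and \<nu>_fin: "\<And>K. compact K \<Longrightarrow> emeasure \<nu> K < \<infinity>"
    using radon by (auto simp: radon_measure_def)
  \<comment> \<open>Passing to a subsequence is harmless: the integrals against \<nu> are already
    fixed as limits of the full sequence.\<close>
  obtain F \<sigma> where \<sigma>: "strict_mono \<sigma>"
      and "limitin hit_miss_topology ((\<lambda>k. magnified x (r k)) \<circ> \<sigma>) F sequentially"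
    using hit_miss_convergent_subsequence[of "\<lambda>k. magnified x (r k)"] compact_magnified
      compact_imp_closed by blast
  then have lim: "limitin hit_miss_topology (\<lambda>k. magnified x (r (\<sigma> k))) F sequentially"
    by (simp add: comp_def)
  have r': "\<And>k. 0 < r (\<sigma> k)" "(\<lambda>k. r (\<sigma> k)) \<longlonglongrightarrow> 0"
    using r LIMSEQ_subseq_LIMSEQ[OF r(2) \<sigma>] by (auto simp: comp_def)
  have F: "F \<in> limit_models (recenter C x)"
    unfolding limit_models_magnified using r' lim by (intro CollectI exI[of _ "\<lambda>k. r (\<sigma> k)"]) simp
  note fin = restr_limit_finite[OF x r' lim]
  define w where "w k = c (\<sigma> k) * r (\<sigma> k) powr s" for k
  have w: "0 < w k" for k using c[of "\<sigma> k"] r(1)[of "\<sigma> k"] by (simp add: w_def)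
  have wlim: "(\<lambda>k. w k * (\<integral>y. f y \<partial>restr (magnified x (r (\<sigma> k))))) \<longlonglongrightarrow> (\<integral>y. f y \<partial>\<nu>)"
    if f: "test_function f" for f
    using LIMSEQ_subseq_LIMSEQ[OF conv[OF f] \<sigma>]
    by (simp add: comp_def w_def integral_blow_up[OF r(1) test_function_measurable[OF f]] mult.assoc)
  \<comment> \<open>If every test function integrated to 0, the measure on \<open>F\<close> would be
    null by uniqueness, contrary to \<open>restr_limit_nonzero\<close>.\<close>
  obtain f0 where f0: "test_function f0" "(\<integral>y. f0 y \<partial>restr F) \<noteq> 0"
  proof (rule ccontr)
    assume "\<not> thesis"
    then have zero: "(\<integral>y. f y \<partial>restr F) = 0" if "test_function f" for f
      using that \<open>\<And>f0. test_function f0 \<Longrightarrow> (\<integral>y. f0 y \<partial>restr F) \<noteq> 0 \<Longrightarrow> thesis\<close> by blast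
    have "restr F = null_measure borel"
      by (rule measure_eqI_test_functions[OF _ fin]) (simp_all add: zero)
    then show False using restr_limit_nonzero[OF x r' lim] by simp
  qed
  define c0 where "c0 = (\<integral>y. f0 y \<partial>\<nu>) / (\<integral>y. f0 y \<partial>restr F)"
  let ?I0 = "\<lambda>k. \<integral>y. f0 y \<partial>restr (magnified x (r (\<sigma> k)))"
  have I0: "?I0 \<longlonglongrightarrow> (\<integral>y. f0 y \<partial>restr F)"
    by (rule restr_convergent[OF x r' lim f0(1)])
  \<comment> \<open>The integrals \<open>?I0 k\<close> have a non-zero limit, so they are eventually
    non-zero and the quotient eventually equals \<open>w k\<close>. This makes the normalising
    constants converge.\<close>
  have quot: "(\<lambda>k. w k * ?I0 k / ?I0 k) \<longlonglongrightarrow> c0"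
    unfolding c0_def by (intro tendsto_divide wlim I0 f0)
  have "\<forall>\<^sub>F k in sequentially. ?I0 k \<noteq> 0"
    using I0 f0(2) by (rule tendsto_imp_eventually_ne)
  then have "\<forall>\<^sub>F k in sequentially. w k * ?I0 k / ?I0 k = w k"
    by eventually_elim simp
  then have wc: "w \<longlonglongrightarrow> c0"
    using quot by (rule Lim_transform_eventually[rotated])
  then have c0: "0 \<le> c0"
    by (rule tendsto_lowerbound) (use w in \<open>auto simp: less_imp_le\<close>)
  have "\<nu> = scale_measure (ennreal c0) (restr F)"
  proof (rule measure_eqI_test_functions[OF \<nu>_sets \<nu>_fin])
    show "sets (scale_measure (ennreal c0) (restr F)) = sets borel" by simp
    show "emeasure (scale_measure (ennreal c0) (restr F)) K < \<infinity>" if "compact K" for K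
      using fin[OF that] by (simp add: ennreal_mult_less_top)
    fix f :: "'a \<Rightarrow> real" assume f: "test_function f"
    have "(\<lambda>k. w k * (\<integral>y. f y \<partial>restr (magnified x (r (\<sigma> k))))) \<longlonglongrightarrow> c0 * (\<integral>y. f y \<partial>restr F)"
      by (intro tendsto_mult wc restr_convergent[OF x r' lim f])
    then have "(\<integral>y. f y \<partial>\<nu>) = c0 * (\<integral>y. f y \<partial>restr F)"
      using wlim[OF f] LIMSEQ_unique by blast
    also have "\<dots> = (\<integral>y. f y \<partial>scale_measure (ennreal c0) (restr F))"
      using c0 test_function_measurable[OF f]
      by (intro integral_scale_measure[symmetric]) (auto cong: measurable_cong_sets)
    finally show "(\<integral>y. f y \<partial>\<nu>) = (\<integral>y. f y \<partial>scale_measure (ennreal c0) (restr F))" .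
  qed
  \<comment> \<open>As a limit of positive numbers \<open>c0\<close> could still be 0; then \<nu>
    would be null.\<close>
  moreover from this have "c0 \<noteq> 0" using nz by auto
  ultimately show "\<nu> \<in> {scale_measure (ennreal c) (restr F) |c F. F \<in> limit_models (recenter C x) \<and> 0 < c}"
    using F c0 by force
qed

end

section \<open>From the hypotheses to the locale\<close>

text \<open>The sum is continuous in the exponent, equals the number of maps at 0 and tends to 0 at
  infinity, so the intermediate value theorem applies. With a single map the solution is
  \<open>s = 0\<close>.\<close>

lemma moran_exponent_exists:
  fixes q :: "nat \<Rightarrow> real"
  assumes J: "finite J" "J \<noteq> {}" and q: "\<And>i. i \<in> J \<Longrightarrow> 0 < q i" "\<And>i. i \<in> J \<Longrightarrow> q i < 1"
  shows "\<exists>s\<ge>0. (\<Sum>i\<in>J. q i powr s) = 1"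
proof -
  let ?f = "\<lambda>t. \<Sum>i\<in>J. q i powr t"
  have "((\<lambda>t. ?f t) \<longlongrightarrow> (\<Sum>i\<in>J. 0)) at_top"
  proof (rule tendsto_sum)
    fix i assume i: "i \<in> J"
    have "ln (q i) < 0" using q[OF i] by simp
    then have "LIM t at_top. ln (q i) * t :> at_bot"
      by (rule filterlim_tendsto_neg_mult_at_bot[OF tendsto_const _ filterlim_ident])
    then have "((\<lambda>t. exp (ln (q i) * t)) \<longlongrightarrow> 0) at_top"
      by (rule filterlim_compose[OF exp_at_bot])
    then show "((\<lambda>t. q i powr t) \<longlongrightarrow> 0) at_top"
      using q(1)[OF i] by (simp add: powr_def mult.commute)
  qed
  then have "\<forall>\<^sub>F t in at_top. ?f t < 1"
    by (intro order_tendstoD(2)) auto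
  then have "\<forall>\<^sub>F t in at_top. ?f t < 1 \<and> 0 \<le> t"
    using eventually_ge_at_top[of "0::real"] by eventually_elim auto
  then obtain t where t: "?f t < 1" "0 \<le> t"
    by (auto simp: eventually_at_top_linorder)
  have "1 \<le> card J" using J by (simp add: Suc_le_eq card_gt_0_iff)
  moreover have "?f 0 = (\<Sum>i\<in>J. 1)"
    using q(1) by (intro sum.cong refl) force
  ultimately have "1 \<le> ?f 0" by simp
  moreover have "continuous_on {0..t} ?f"
    using q(1) by (intro continuous_intros) force
  ultimately show ?thesis
    using IVT2'[of ?f t 1 0] t by auto
qed

lemma separated_pieces:
  assumes J: "finite J" and D: "\<And>i. i \<in> J \<Longrightarrow> compact (D i)" "disjoint_family_on D J"
  shows "\<exists>\<delta>>0. \<forall>i\<in>J. \<forall>j\<in>J. i \<noteq> j \<longrightarrow> (\<forall>x\<in>D i. \<forall>y\<in>D j. \<delta> \<le> dist x (y :: 'a::heine_borel))"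
proof -
  let ?P = "{(i, j). i \<in> J \<and> j \<in> J \<and> i \<noteq> j}"
  have "\<exists>d>0. \<forall>x\<in>D (fst p). \<forall>y\<in>D (snd p). d \<le> dist x y" if "p \<in> ?P" for p
  proof -
    have p: "fst p \<in> J" "snd p \<in> J" "D (fst p) \<inter> D (snd p) = {}"
      using that disjoint_family_onD[OF D(2), of "fst p" "snd p"] by auto
    show ?thesis
      using separate_compact_closed[OF D(1)[OF p(1)] compact_imp_closed[OF D(1)[OF p(2)]] p(3)] .
  qed
  then have "\<forall>p\<in>?P. \<exists>d. 0 < d \<and> (\<forall>x\<in>D (fst p). \<forall>y\<in>D (snd p). d \<le> dist x y)" by blast
  then obtain d where d: "\<forall>p\<in>?P. 0 < d p \<and> (\<forall>x\<in>D (fst p). \<forall>y\<in>D (snd p). d p \<le> dist x y)"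
    unfolding bchoice_iff ..
  have "finite ?P" by (rule finite_subset[of _ "J \<times> J"]) (use J in auto)
  \<comment> \<open>The inserted 1 keeps the minimum defined when there is no pair of distinct
    indices.\<close>
  then have fin: "finite (insert 1 (d ` ?P))" by simp
  show ?thesis
  proof (intro exI[of _ "Min (insert 1 (d ` ?P))"] conjI ballI impI)
    show "0 < Min (insert 1 (d ` ?P))" using fin d by (subst Min_gr_iff) auto
    fix i j x y assume ij: "i \<in> J" "j \<in> J" "i \<noteq> j" "x \<in> D i" "y \<in> D j"
    have "Min (insert 1 (d ` ?P)) \<le> d (i, j)"
      using fin ij by (intro Min_le) auto
    also have "\<dots> \<le> dist x y" using d ij by force
    finally show "Min (insert 1 (d ` ?P)) \<le> dist x y" .
  qed
qed

lemma similitude_similarity: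
  assumes "similitude f"
  shows "\<exists>r. 0 < r \<and> r < 1 \<and> similarity_on r UNIV f"
proof -
  obtain r g z where f: "0 < r" "r < 1" "orthogonal_transformation g" "\<And>x. f x = r *\<^sub>R g x + z"
    using assms by (auto simp: similitude_def)
  have "dist (f x) (f y) = r * dist x y" for x y
  proof -
    have "f x - f y = r *\<^sub>R g (x - y)"
      using f(3,4) by (simp add: scaleR_diff_right linear_diff orthogonal_transformation_linear)
    then show ?thesis using f(1,3) by (simp add: dist_norm orthogonal_transformation_norm)
  qed
  then show ?thesis using f(1,2) by (auto simp: similarity_on_def)
qed

lemma separated_ifs_exists:
  assumes "self_similar_set m \<phi> C" "strong_separation m \<phi> C"
  shows "\<exists>q \<delta> lo hi s. separated_ifs {1..m} \<phi> q C \<delta> lo hi s"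
proof -
  let ?J = "{1..m}"
  have simil: "\<And>i. i \<in> ?J \<Longrightarrow> similitude (\<phi> i)" and C: "compact C" "C \<noteq> {}" "C = (\<Union>i\<in>?J. \<phi> i ` C)"
    using assms(1) by (auto simp: self_similar_set_def)
  have ne: "?J \<noteq> {}" using C by blast
  have "\<forall>i\<in>?J. \<exists>r. 0 < r \<and> r < 1 \<and> similarity_on r UNIV (\<phi> i)"
    using simil similitude_similarity by blast
  then obtain q where q: "\<And>i. i \<in> ?J \<Longrightarrow> 0 < q i" "\<And>i. i \<in> ?J \<Longrightarrow> q i < 1"
      "\<And>i. i \<in> ?J \<Longrightarrow> similarity_on (q i) UNIV (\<phi> i)"
    by metis
  obtain s where s: "0 \<le> s" "(\<Sum>i\<in>?J. q i powr s) = 1"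
    using moran_exponent_exists[of ?J q] ne q(1,2) by auto
  have comp: "compact (\<phi> i ` C)" if "i \<in> ?J" for i
    using continuous_on_subset[OF similarity_on_continuous[OF q(3)[OF that]] subset_UNIV] C(1)
    by (rule compact_continuous_image)
  have "\<exists>\<delta>>0. \<forall>i\<in>?J. \<forall>j\<in>?J. i \<noteq> j \<longrightarrow> (\<forall>x\<in>\<phi> i ` C. \<forall>y\<in>\<phi> j ` C. \<delta> \<le> dist x y)"
    using finite_atLeastAtMost comp assms(2)[unfolded strong_separation_def] by (rule separated_pieces)
  then obtain \<delta> where \<delta>: "0 < \<delta>"
      "\<forall>i\<in>?J. \<forall>j\<in>?J. i \<noteq> j \<longrightarrow> (\<forall>x\<in>\<phi> i ` C. \<forall>y\<in>\<phi> j ` C. \<delta> \<le> dist x y)"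
    by (elim exE conjE) (rule that)
  have "separated_ifs ?J \<phi> q C \<delta> (Min (q ` ?J)) (Max (q ` ?J)) s"
  proof
    show "0 < Min (q ` ?J)" using q ne by (subst Min_gr_iff) auto
    show "Max (q ` ?J) < 1" using q ne by (subst Max_less_iff) auto
  qed (use C q s \<delta> in auto)
  then show ?thesis by blast
qed

theorem theorem1p1:
  fixes C :: "'a::euclidean_space set"
    and \<phi> :: "nat \<Rightarrow> 'a \<Rightarrow> 'a"
    and m :: nat
    and s :: real
    and \<mu> :: "'a measure"
    and x :: 'a
  assumes "self_similar_set m \<phi> C"
    and "strong_separation m \<phi> C"
    and "s = hausdorff_dim C"
    and "\<mu> = measure_restr (hausdorff_measure s) C"
    and "x \<in> C"
  shows "tangent_measures \<mu> x =
    {scale_measure (ennreal c) (measure_restr (hausdorff_measure s) F) |c F.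
       F \<in> limit_models (recenter C x) \<and> 0 < c}"
proof -
  obtain q \<delta> lo hi t where "separated_ifs {1..m} \<phi> q C \<delta> lo hi t"
    using separated_ifs_exists[OF assms(1,2)] by blast
  then interpret separated_ifs "{1..m}" \<phi> q C \<delta> lo hi t .
  \<comment> \<open>The exponent \<open>s\<close> of the statement is the dimension, while
    \<open>t\<close> solves Moran's equation.\<close>
  have "s = t" using assms(3) hausdorff_dim_eq by simp
  then show ?thesis using tangent_measures_eq[OF assms(5)] assms(4) by simp
qed

end
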